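(* A metric fractal $(K,\mathcal F)$ has the doubling property if and only if for some $n\in\mathbb N$ (with $n\ge 1$) the metric fractal $(K,\mathcal F^{\circ n})$ is equi-Hölder equivalent to a fractal in a Euclidean space.
   Context: A self-map $f$ of a metric space $(M,d)$ is contracting if its Lipschitz constant $\mathrm{Lip}(f)=\sup_{x\neq y} d(f(x),f(y))/d(x,y)$ is $<1$. A metric fractal is a pair $(K,\mathcal F)$ consisting of a (non-empty) compact metric space $K$ and a finite family $\mathcal F$ of contracting self-maps of $K$ with $K=\bigcup_{f\in\mathcal F}f(K)$. For $n\ge1$ put $\mathcal F^{\circ n}=\{f_1\circ\dots\circ f_n:f_1,\dots,f_n\in\mathcal F\}$; then $(K,\mathcal F^{\circ n})$ is again a metric fractal. A metric space $X$ has the doubling property if for some $N\in\mathbb N$ each subset $S\subset X$ can be covered by at most $N$ sets of diameter $\le\frac12\mathrm{diam}(S)$. A metric fractal has the doubling property if its underlying metric space $K$ does. A Euclidean space is a finite-dimensional (real) Hilbert space (equivalently $\mathbb R^d$ with the standard Euclidean metric for some $d$). A fractal in a complete metric space $M$ is a metric fractal $(L,\mathcal G)$ such that $L\subset M$ carries the metric inherited from $M$ and each $g\in\mathcal G$ is the restriction to $L$ of a contracting self-map of $M$. Two metric fractals $(X,\mathcal F_X)$, $(Y,\mathcal F_Y)$ are equi-Hölder equivalent if there is an equi-Hölder homeomorphism $h:X\to Y$ with $\mathcal F_Y=\{h\circ f\circ h^{-1}:f\in\mathcal F_X\}$; a homeomorphism $h$ is equi-Hölder if there are positive reals $c,C,\alpha$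 with $c\,d_X(x,y)^\alpha\le d_Y(h(x),h(y))\le C\,d_X(x,y)^\alpha$ for all $x,y\in X$. *)

theory Defs
  imports "HOL-Analysis.Analysis"
begin

text \<open>
  Metric spaces are elements of the library type \<open>'a metric\<close> (a carrier set with a metric on it), so
  that subspaces and Euclidean spaces of varying dimension live on the same footing. A self-map of
  a set \<open>A\<close> is an extensional function, i.e. an element of \<open>A \<rightarrow>\<^sub>E A\<close>; equality of such functions
  is equality of maps on \<open>A\<close>, which makes finiteness and equality of families of
  self-maps meaningful.
\<close>

text \<open>The suprema are taken in \<open>ennreal\<close>: the empty supremum is \<open>0\<close>, an unbounded one is \<open>\<infinity>\<close>.\<close>

definition Lip :: "'a metric \<Rightarrow> ('a \<Rightarrow> 'a) \<Rightarrow> ennreal" where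
  "Lip M f = (SUP (x, y) \<in> {(x, y). x \<in> mspace M \<and> y \<in> mspace M \<and> x \<noteq> y}.
                ennreal (mdist M (f x) (f y) / mdist M x y))"

definition contracting :: "'a metric \<Rightarrow> ('a \<Rightarrow> 'a) \<Rightarrow> bool" where
  "contracting M f \<longleftrightarrow> f \<in> mspace M \<rightarrow>\<^sub>E mspace M \<and> Lip M f < 1"

definition mdiam :: "'a metric \<Rightarrow> 'a set \<Rightarrow> ennreal" where
  "mdiam M S = (SUP (x, y) \<in> S \<times> S. ennreal (mdist M x y))"

definition metric_fractal :: "'a metric \<Rightarrow> ('a \<Rightarrow> 'a) set \<Rightarrow> bool" where
  "metric_fractal K F \<longleftrightarrow>
     mspace K \<noteq> {} \<and> compact_space (mtopology_of K) \<and>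
     finite F \<and> (\<forall>f\<in>F. contracting K f) \<and>
     mspace K = (\<Union>f\<in>F. f ` mspace K)"

text \<open>
  All composites \<open>f\<^sub>1 \<circ> \<dots> \<circ> f\<^sub>n\<close> with \<open>f\<^sub>1, \<dots>, f\<^sub>n \<in> F\<close>, formed as extensional functions on the
  carrier; the list is \<open>[f\<^sub>1, \<dots>, f\<^sub>n]\<close>.
\<close>

definition comp_power :: "'a metric \<Rightarrow> ('a \<Rightarrow> 'a) set \<Rightarrow> nat \<Rightarrow> ('a \<Rightarrow> 'a) set" where
  "comp_power K F n =
     {foldr (compose (mspace K)) fs (restrict id (mspace K)) | fs. length fs = n \<and> set fs \<subseteq> F}"

definition doubling :: "'a metric \<Rightarrow> bool" where
  "doubling M \<longleftrightarrow>
     (\<exists>N::nat. \<forall>S \<subseteq> mspace M. \<exists>\<T>. finite \<T> \<and> card \<T> \<le> N \<and> S \<subseteq> \<Union>\<T> \<and>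
        (\<forall>T\<in>\<T>. T \<subseteq> mspace M \<and> mdiam M T \<le> mdiam M S / 2))"

text \<open>
  \<open>\<real>\<^sup>d\<close> with its Euclidean metric. As in the library's \<open>Euclidean_space d\<close>, its points are
  the sequences vanishing from index \<open>d\<close> on; the dimension is thus a term and can be quantified over.
\<close>

definition euclid :: "nat \<Rightarrow> (nat \<Rightarrow> real) metric" where
  "euclid d = metric ({x. \<forall>i\<ge>d. x i = 0}, \<lambda>x y. L2_set (\<lambda>i. x i - y i) {..<d})"

lemma Metric_space_euclid:
  fixes d :: nat
  shows "Metric_space {x. \<forall>i\<ge>d. x i = 0} (\<lambda>x y. L2_set (\<lambda>i. x i - y i) {..<d})"
proof
  fix x y :: "nat \<Rightarrow> real"
  show "0 \<le> L2_set (\<lambda>i. x i - y i) {..<d}"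
    by (rule L2_set_nonneg)
  show "L2_set (\<lambda>i. x i - y i) {..<d} = L2_set (\<lambda>i. y i - x i) {..<d}"
    by (simp add: L2_set_def power2_commute)
  assume x: "x \<in> {x. \<forall>i\<ge>d. x i = 0}" and y: "y \<in> {x. \<forall>i\<ge>d. x i = 0}"
  show "L2_set (\<lambda>i. x i - y i) {..<d} = 0 \<longleftrightarrow> x = y"
  proof
    assume "L2_set (\<lambda>i. x i - y i) {..<d} = 0"
    then have "\<forall>i<d. x i = y i"
      by (simp add: L2_set_eq_0_iff)
    moreover have "\<forall>i\<ge>d. x i = y i"
      using x y by simp
    ultimately show "x = y"
      using not_le by (intro ext) blast
  qed (simp add: L2_set_def)
next
  fix x y z :: "nat \<Rightarrow> real"
  have "L2_set (\<lambda>i. x i - z i) {..<d} = L2_set (\<lambda>i. (x i - y i) + (y i - z i)) {..<d}"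
    by simp
  also have "\<dots> \<le> L2_set (\<lambda>i. x i - y i) {..<d} + L2_set (\<lambda>i. y i - z i) {..<d}"
    by (rule L2_set_triangle_ineq)
  finally show "L2_set (\<lambda>i. x i - z i) {..<d}
      \<le> L2_set (\<lambda>i. x i - y i) {..<d} + L2_set (\<lambda>i. y i - z i) {..<d}" .
qed

lemma mspace_euclid [simp]: "mspace (euclid d) = {x. \<forall>i\<ge>d. x i = 0}"
  unfolding euclid_def by (rule Metric_space.mspace_metric [OF Metric_space_euclid])

lemma mdist_euclid [simp]: "mdist (euclid d) x y = L2_set (\<lambda>i. x i - y i) {..<d}"
  unfolding euclid_def by (simp add: Metric_space.mdist_metric [OF Metric_space_euclid])

definition fractal_in :: "'a metric \<Rightarrow> 'a set \<Rightarrow> ('a \<Rightarrow> 'a) set \<Rightarrow> bool" where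
  "fractal_in M L G \<longleftrightarrow>
     mcomplete_of M \<and> L \<subseteq> mspace M \<and> metric_fractal (submetric M L) G \<and>
     (\<forall>g\<in>G. \<exists>g'. contracting M g' \<and> g = restrict g' L)"

definition equi_Hoelder_homeomorphism :: "'a metric \<Rightarrow> 'b metric \<Rightarrow> ('a \<Rightarrow> 'b) \<Rightarrow> bool" where
  "equi_Hoelder_homeomorphism X Y h \<longleftrightarrow>
     homeomorphic_map (mtopology_of X) (mtopology_of Y) h \<and>
     (\<exists>c C \<alpha>::real. c > 0 \<and> C > 0 \<and> \<alpha> > 0 \<and>
        (\<forall>x\<in>mspace X. \<forall>y\<in>mspace X.
           c * mdist X x y powr \<alpha> \<le> mdist Y (h x) (h y) \<and>
           mdist Y (h x) (h y) \<le> C * mdist X x y powr \<alpha>))"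

definition equi_Hoelder_equivalent ::
    "'a metric \<Rightarrow> ('a \<Rightarrow> 'a) set \<Rightarrow> 'b metric \<Rightarrow> ('b \<Rightarrow> 'b) set \<Rightarrow> bool" where
  "equi_Hoelder_equivalent X FX Y FY \<longleftrightarrow>
     (\<exists>h. equi_Hoelder_homeomorphism X Y h \<and>
          FY = {restrict (h \<circ> f \<circ> inv_into (mspace X) h) (mspace Y) | f. f \<in> FX})"

end

theory Submission
  imports Defs
begin

text \<open>
  If \<open>h\<close> maps \<open>K\<close> into \<open>\<real>\<^sup>d\<close> and distorts distances like \<open>r \<mapsto> r powr \<alpha>\<close> up to constant factors,
  then a partition of \<open>\<real>\<^sup>d\<close> into cubes pulls back to covers of subsets of \<open>K\<close>. A set of diameter
  \<open>D\<close> has an image of diameter at most \<open>C * D powr \<alpha>\<close>, and a cell whose image has diameter at most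
  \<open>c * (D / 2) powr \<alpha>\<close> has itself diameter at most \<open>D / 2\<close>. The ratio of these two lengths is
  independent of \<open>D\<close>, so the number of cubes needed is bounded
  (\<open>doubling_if_Hoelder_into_euclid\<close>).

  Conversely, a bounded doubling space with its metric replaced by the square root of that metric
  has a bi-Lipschitz embedding \<open>h\<close> into some \<open>\<real>\<^sup>d\<close>; this is Assouad's theorem
  (\<open>Assouad_snowflake_embedding\<close>). Conjugating a map of Lipschitz constant \<open>l\<close> by such an \<open>h\<close>
  gives a map of Lipschitz constant at most \<open>C / c * sqrt l\<close>. This need not be less than \<open>1\<close>, but
  the maps in the \<open>n\<close>-th iterate of \<open>F\<close> have Lipschitz constant at most \<open>l ^ n\<close>, so passing to a
  large \<open>n\<close> makes all conjugated maps as contracting as desired. That is why an iterate of the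
  family appears in the theorem. Enough room is then left to extend each conjugated map to a
  contraction of the whole of \<open>\<real>\<^sup>d\<close>, by extending its coordinates separately at the price of a
  factor \<open>d\<close> (\<open>contracting_extension_euclid\<close>).

  For Assouad's theorem, fix scales \<open>t\<^sub>j = \<tau> / 4 ^ j\<close>. At each scale, a maximal separated set can
  be coloured with a number of colours that does not depend on \<open>j\<close> such that equally coloured
  points are far apart compared with \<open>t\<^sub>j\<close>. The truncated distances to the colour classes are
  \<open>1\<close>-Lipschitz functions of size at most \<open>2 * t\<^sub>j\<close>, and one of them distinguishes any two points
  whose distance is comparable to \<open>t\<^sub>j\<close> (\<open>distinguishing_functions_at_scale\<close>). These functions,
  divided by \<open>sqrt t\<^sub>j\<close> up to a constant, are summed over \<open>j\<close>. For two points at distance about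
  \<open>t\<^sub>J\<close>, the increments of the summands decay geometrically in \<open>\<bar>j - J\<bar>\<close>. Summing only over \<open>j\<close> in
  a fixed residue class modulo \<open>7\<close>, with a separate coordinate for every class, makes the decay so
  fast that the summand at \<open>J\<close> cannot be cancelled by the others (\<open>suminf_near_peak\<close>).
\<close>

section \<open>Lipschitz constants and diameters as real numbers\<close>

lemma contracting_iff_Lipschitz:
  "contracting M f \<longleftrightarrow> f \<in> mspace M \<rightarrow>\<^sub>E mspace M \<and>
     (\<exists>l::real. 0 \<le> l \<and> l < 1 \<and>
        (\<forall>x\<in>mspace M. \<forall>y\<in>mspace M. mdist M (f x) (f y) \<le> l * mdist M x y))"
proof -
  have "\<exists>l::real. 0 \<le> l \<and> l < 1 \<and>
        (\<forall>x\<in>mspace M. \<forall>y\<in>mspace M. mdist M (f x) (f y) \<le> l * mdist M x y)"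
    if f: "f \<in> mspace M \<rightarrow>\<^sub>E mspace M" and L: "Lip M f < 1"
  proof -
    define l where "l = enn2real (Lip M f)"
    have Ll: "Lip M f = ennreal l"
      using L by (simp add: l_def less_top order_less_trans[of _ 1])
    have "0 \<le> l" by (simp add: l_def)
    moreover have "l < 1"
      using L \<open>0 \<le> l\<close> unfolding Ll by (simp add: ennreal_less_one_iff)
    moreover have "mdist M (f x) (f y) \<le> l * mdist M x y"
      if xy: "x \<in> mspace M" "y \<in> mspace M" for x y
    proof (cases "x = y")
      case True
      then show ?thesis using f xy by (metis PiE_mem mdist_zero mult_zero_right order_refl)
    next
      case False
      have "ennreal (mdist M (f x) (f y) / mdist M x y) \<le> ennreal l"
        unfolding Ll[symmetric] Lip_def
        by (rule SUP_upper2[of "(x, y)"]) (use xy False in auto)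
      then have "mdist M (f x) (f y) / mdist M x y \<le> l"
        using \<open>0 \<le> l\<close> by (simp add: ennreal_le_iff)
      moreover have "0 < mdist M x y"
        using xy False by (metis less_eq_real_def mdist_nonneg mdist_zero)
      ultimately show ?thesis by (simp add: field_simps)
    qed
    ultimately show ?thesis by blast
  qed
  moreover have "Lip M f < 1"
    if "0 \<le> l" "l < 1"
      and le: "\<forall>x\<in>mspace M. \<forall>y\<in>mspace M. mdist M (f x) (f y) \<le> l * mdist M x y" for l :: real
  proof -
    have "Lip M f \<le> ennreal l"
      unfolding Lip_def
    proof (rule SUP_least, clarify)
      fix x y assume xy: "x \<in> mspace M" "y \<in> mspace M" "x \<noteq> y"
      have "0 < mdist M x y"
        using xy by (metis less_eq_real_def mdist_nonneg mdist_zero)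
      then show "ennreal (mdist M (f x) (f y) / mdist M x y) \<le> ennreal l"
        using le xy by (intro ennreal_leI) (simp add: field_simps)
    qed
    also have "\<dots> < 1" using that by (simp add: ennreal_less_one_iff)
    finally show ?thesis .
  qed
  ultimately show ?thesis unfolding contracting_def by blast
qed

lemma compact_space_imp_bounded_metric:
  assumes "compact_space (mtopology_of K)"
  obtains B where "0 < B" "\<And>x y. x \<in> mspace K \<Longrightarrow> y \<in> mspace K \<Longrightarrow> mdist K x y \<le> B"
proof -
  interpret M: Metric_space "mspace K" "mdist K" by simp
  have "M.mbounded (mspace K)"
    using assms M.compactin_imp_mbounded
    by (metis M.topspace_mtopology compact_space_def mtopology_of_def)
  then show ?thesis
    using that unfolding M.mbounded_alt_pos by blast
qed

lemma mdiam_le_iff: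
  assumes "0 \<le> D"
  shows "mdiam M S \<le> ennreal D \<longleftrightarrow> (\<forall>x\<in>S. \<forall>y\<in>S. mdist M x y \<le> D)"
  using assms by (auto simp: mdiam_def SUP_le_iff ennreal_le_iff)

text \<open>
  Diameter bounds are stated through real distances, since the scales occurring below are real
  numbers on which one calculates freely.
\<close>
definition small_cover :: "'a metric \<Rightarrow> nat \<Rightarrow> real \<Rightarrow> 'a set \<Rightarrow> bool" where
  "small_cover M N e S \<longleftrightarrow> (\<exists>\<T>. finite \<T> \<and> card \<T> \<le> N \<and> S \<subseteq> \<Union>\<T> \<and>
     (\<forall>T\<in>\<T>. T \<subseteq> mspace M \<and> (\<forall>x\<in>T. \<forall>y\<in>T. mdist M x y \<le> e)))"

text \<open>
  The number \<open>D\<close> is any upper bound for the diameter, not the diameter itself, so that the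
  condition can be applied again to the members of a cover.
\<close>
definition doubling_with :: "nat \<Rightarrow> 'a metric \<Rightarrow> bool" where
  "doubling_with N M \<longleftrightarrow> (\<forall>S D. S \<subseteq> mspace M \<longrightarrow> 0 \<le> D \<longrightarrow>
     (\<forall>x\<in>S. \<forall>y\<in>S. mdist M x y \<le> D) \<longrightarrow> small_cover M N (D / 2) S)"

text \<open>
  Compactness makes all diameters finite, which is needed to pass from the extended diameter of a
  set to a real bound for it.
\<close>
lemma doubling_iff_doubling_with:
  assumes K: "compact_space (mtopology_of K)"
  shows "doubling K \<longleftrightarrow> (\<exists>N. doubling_with N K)"
proof
  assume "doubling K"
  then obtain N :: nat where N: "\<forall>S\<subseteq>mspace K. \<exists>\<T>. finite \<T> \<and> card \<T> \<le> N \<and> S \<subseteq> \<Union>\<T> \<and>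
        (\<forall>T\<in>\<T>. T \<subseteq> mspace K \<and> mdiam K T \<le> mdiam K S / 2)"
    unfolding doubling_def by (elim exE)
  have "small_cover K N (D / 2) S"
    if S: "S \<subseteq> mspace K" and D: "0 \<le> D" "\<forall>x\<in>S. \<forall>y\<in>S. mdist K x y \<le> D" for S and D :: real
  proof -
    from N[rule_format, OF S] obtain \<T> where T: "finite \<T>" "card \<T> \<le> N" "S \<subseteq> \<Union>\<T>"
        "\<forall>T\<in>\<T>. T \<subseteq> mspace K \<and> mdiam K T \<le> mdiam K S / 2"
      by (elim exE conjE)
    have "mdiam K S / 2 \<le> ennreal D / 2"
      using D by (intro divide_right_mono_ennreal) (simp add: mdiam_le_iff)
    also have "\<dots> = ennreal (D / 2)"
      using D by (simp add: ennreal_divide_numeral)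
    finally have "mdiam K T \<le> ennreal (D / 2)" if "T \<in> \<T>" for T
      using T(4) that by (meson order_trans)
    then show ?thesis
      using T D unfolding small_cover_def by (intro exI[of _ \<T>]) (simp add: mdiam_le_iff)
  qed
  then show "\<exists>N. doubling_with N K" unfolding doubling_with_def by blast
next
  assume "\<exists>N. doubling_with N K"
  then obtain N where N: "\<forall>S D. S \<subseteq> mspace K \<longrightarrow> 0 \<le> D \<longrightarrow>
      (\<forall>x\<in>S. \<forall>y\<in>S. mdist K x y \<le> D) \<longrightarrow> small_cover K N (D / 2) S"
    unfolding doubling_with_def by (elim exE)
  obtain B where B: "0 < B" "\<And>x y. x \<in> mspace K \<Longrightarrow> y \<in> mspace K \<Longrightarrow> mdist K x y \<le> B"
    using compact_space_imp_bounded_metric[OF K] by blast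
  show "doubling K"
    unfolding doubling_def
  proof (intro exI[of _ N] allI impI)
    fix S assume S: "S \<subseteq> mspace K"
    define D where "D = enn2real (mdiam K S)"
    have "mdiam K S \<le> ennreal B"
      using S B by (subst mdiam_le_iff) auto
    then have DS: "mdiam K S = ennreal D"
      unfolding D_def by (metis ennreal_enn2real ennreal_less_top order_le_less_trans)
    have D: "0 \<le> D" by (simp add: D_def)
    have "\<forall>x\<in>S. \<forall>y\<in>S. mdist K x y \<le> D"
      using mdiam_le_iff[OF D, of K S] DS by simp
    then have "small_cover K N (D / 2) S"
      using N S D by blast
    then obtain \<T> where T: "finite \<T>" "card \<T> \<le> N" "S \<subseteq> \<Union>\<T>"
        "\<forall>T\<in>\<T>. T \<subseteq> mspace K \<and> (\<forall>x\<in>T. \<forall>y\<in>T. mdist K x y \<le> D / 2)"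
      unfolding small_cover_def by (elim exE conjE)
    have "mdiam K S / 2 = ennreal (D / 2)"
      using D DS by (simp add: ennreal_divide_numeral)
    then show "\<exists>\<T>. finite \<T> \<and> card \<T> \<le> N \<and> S \<subseteq> \<Union>\<T> \<and>
        (\<forall>T\<in>\<T>. T \<subseteq> mspace K \<and> mdiam K T \<le> mdiam K S / 2)"
      using T D by (intro exI[of _ \<T>]) (simp add: mdiam_le_iff)
  qed
qed

section \<open>The metric of \<open>\<real>\<^sup>d\<close> in terms of coordinates\<close>

lemma coordinate_le_euclid:
  assumes "i < d"
  shows "\<bar>x i - y i\<bar> \<le> mdist (euclid d) x y"
  using member_le_L2_set[of "{..<d}" i "\<lambda>i. \<bar>x i - y i\<bar>"] assms by (simp add: L2_set_def)

lemma euclid_le_coordinates: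
  assumes "\<And>i. i < d \<Longrightarrow> \<bar>x i - y i\<bar> \<le> e"
  shows "mdist (euclid d) x y \<le> d * e"
proof -
  have "mdist (euclid d) x y \<le> (\<Sum>i<d. \<bar>x i - y i\<bar>)"
    using L2_set_le_sum_abs[of "\<lambda>i. x i - y i" "{..<d}"] by simp
  also have "\<dots> \<le> (\<Sum>i<d. e)"
    using assms by (intro sum_mono) simp
  finally show ?thesis by simp
qed

lemma mcomplete_euclid: "mcomplete_of (euclid d)"
proof -
  interpret M: Metric_space "mspace (euclid d)" "mdist (euclid d)" by (rule Metric_space_mspace_mdist)
  have "\<exists>x. limitin M.mtopology \<sigma> x sequentially" if \<sigma>: "M.MCauchy \<sigma>" for \<sigma>
  proof -
    have \<sigma>0: "\<sigma> n i = 0" if "i \<ge> d" for n i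
      using \<sigma> that unfolding M.MCauchy_def by auto
    have cau: "\<exists>N. \<forall>n n'. N \<le> n \<longrightarrow> N \<le> n' \<longrightarrow> mdist (euclid d) (\<sigma> n) (\<sigma> n') < e" if "e > 0" for e
      using \<sigma> that unfolding M.MCauchy_def by blast
    have "convergent (\<lambda>n. \<sigma> n i)" for i
    proof (cases "i < d")
      case True
      then show ?thesis
        unfolding Cauchy_convergent_iff[symmetric] Cauchy_def dist_real_def
        using cau coordinate_le_euclid by (meson order_le_less_trans)
    qed (simp add: \<sigma>0 convergent_const)
    then obtain l where l: "\<And>i. (\<lambda>n. \<sigma> n i) \<longlonglongrightarrow> l i"
      unfolding convergent_def by metis
    define x where "x i = (if i < d then l i else 0)" for i
    have "x \<in> mspace (euclid d)" by (simp add: x_def)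
    moreover have "(\<lambda>n. mdist (euclid d) (\<sigma> n) x) \<longlonglongrightarrow> 0"
    proof (rule tendsto_sandwich)
      show "\<forall>\<^sub>F n in sequentially. 0 \<le> mdist (euclid d) (\<sigma> n) x"
        by (simp only: mdist_nonneg eventually_True)
      show "\<forall>\<^sub>F n in sequentially. mdist (euclid d) (\<sigma> n) x \<le> (\<Sum>i<d. \<bar>\<sigma> n i - x i\<bar>)"
        using L2_set_le_sum_abs by (intro always_eventually) auto
      have "(\<lambda>n. \<Sum>i<d. \<bar>\<sigma> n i - x i\<bar>) \<longlonglongrightarrow> (\<Sum>i<d. 0)"
        using l by (intro tendsto_sum tendsto_rabs_zero) (simp add: x_def LIM_zero_iff)
      then show "(\<lambda>n. \<Sum>i<d. \<bar>\<sigma> n i - x i\<bar>) \<longlonglongrightarrow> 0" by simp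
    qed simp
    moreover have "\<sigma> n \<in> mspace (euclid d)" for n
      using \<sigma> unfolding M.MCauchy_def by blast
    ultimately show ?thesis
      unfolding M.limitin_metric_dist_null by (auto intro: always_eventually)
  qed
  then show ?thesis unfolding mcomplete_of_def M.mcomplete_def by blast
qed

section \<open>Hoelder maps into \<open>\<real>\<^sup>d\<close>\<close>

text \<open>
  The lower bound gives injectivity and the upper bound continuity; compactness of \<open>K\<close> then takes
  care of the continuity of the inverse.
\<close>
lemma Hoelder_imp_equi_Hoelder_homeomorphism:
  assumes K: "compact_space (mtopology_of K)"
    and hL: "h ` mspace K = L" and LM: "L \<subseteq> mspace M"
    and pos: "0 < c" "0 < C" "0 < \<alpha>"
    and lo: "\<And>x y. x \<in> mspace K \<Longrightarrow> y \<in> mspace K \<Longrightarrow> c * mdist K x y powr \<alpha> \<le> mdist M (h x) (h y)"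
    and up: "\<And>x y. x \<in> mspace K \<Longrightarrow> y \<in> mspace K \<Longrightarrow> mdist M (h x) (h y) \<le> C * mdist K x y powr \<alpha>"
  shows "equi_Hoelder_homeomorphism K (submetric M L) h"
proof -
  interpret X: Metric_space "mspace K" "mdist K" by (rule Metric_space_mspace_mdist)
  interpret Y: Metric_space L "mdist M"
    by (metis LM Metric_space.subspace Metric_space_mspace_mdist)
  have Ytop: "mtopology_of (submetric M L) = Y.mtopology"
    using LM by (simp add: mtopology_of_def Int_absorb2)
  have inj: "inj_on h (mspace K)"
  proof (rule inj_onI, rule ccontr)
    fix x y assume xy: "x \<in> mspace K" "y \<in> mspace K" "h x = h y" "x \<noteq> y"
    then have "0 < mdist K x y" by simp
    then have "0 < c * mdist K x y powr \<alpha>" using pos by simp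
    also have "\<dots> \<le> mdist M (h x) (h y)" using lo xy by blast
    also have "\<dots> = 0" using xy hL by (metis Y.mdist_zero imageI)
    finally show False by simp
  qed
  have "continuous_map X.mtopology Y.mtopology h"
    unfolding X.metric_continuous_map[OF Y.Metric_space_axioms]
  proof (intro conjI ballI allI impI)
    show "h ` mspace K \<subseteq> L" using hL by simp
    fix a and e :: real assume a: "a \<in> mspace K" and e: "0 < e"
    have "mdist M (h a) (h x) < e"
      if x: "x \<in> mspace K" "mdist K a x < (e / C) powr (1 / \<alpha>)" for x
    proof -
      have "mdist K a x powr \<alpha> < ((e / C) powr (1 / \<alpha>)) powr \<alpha>"
        using x pos by (intro powr_less_mono2) auto
      also have "\<dots> = e / C" using pos e by (simp add: powr_powr)
      finally have "C * mdist K a x powr \<alpha> < e" using pos by (simp add: field_simps)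
      then show ?thesis using up[OF a x(1)] by linarith
    qed
    moreover have "0 < (e / C) powr (1 / \<alpha>)" using e pos by simp
    ultimately show "\<exists>\<delta>>0. \<forall>x. x \<in> mspace K \<and> mdist K a x < \<delta> \<longrightarrow> mdist M (h a) (h x) < e"
      by blast
  qed
  then have "homeomorphic_map (mtopology_of K) (mtopology_of (submetric M L)) h"
    using K inj hL unfolding Ytop unfolding mtopology_of_def
    by (intro continuous_imp_homeomorphic_map) (auto simp: Y.Hausdorff_space_mtopology)
  then show ?thesis
    unfolding equi_Hoelder_homeomorphism_def using pos lo up
    by (simp only: mdist_submetric) blast
qed

text \<open>
  The cubes have side \<open>c * (D / 2) powr \<alpha> / (d + 1)\<close>, so that the diameter of a cube is at most
  the size \<open>c * (D / 2) powr \<alpha>\<close> that forces the preimage to have diameter at most \<open>D / 2\<close>. The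
  image of the given set lies within \<open>C * D powr \<alpha>\<close> of one of its points; measured in sides of
  cubes this is \<open>C * (d + 1) * 2 powr \<alpha> / c\<close>, in which \<open>D\<close> has cancelled.
\<close>
lemma doubling_if_Hoelder_into_euclid:
  assumes K: "compact_space (mtopology_of K)"
    and pos: "0 < c" "0 < C" "0 < \<alpha>"
    and lo: "\<And>x y. x \<in> mspace K \<Longrightarrow> y \<in> mspace K \<Longrightarrow>
               c * mdist K x y powr \<alpha> \<le> mdist (euclid d) (h x) (h y)"
    and up: "\<And>x y. x \<in> mspace K \<Longrightarrow> y \<in> mspace K \<Longrightarrow>
               mdist (euclid d) (h x) (h y) \<le> C * mdist K x y powr \<alpha>"
  shows "doubling K"
proof -
  define m :: int where "m = \<lceil>C * (d + 1) * 2 powr \<alpha> / c\<rceil>"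
  define cells where "cells = PiE {..<d} (\<lambda>_. {-m..m})"
  have fin: "finite cells" unfolding cells_def by (intro finite_PiE) auto
  \<comment> \<open>For \<open>D = 0\<close> the side of the cubes is \<open>0\<close>; then the set covers itself, which needs \<open>N \<ge> 1\<close>.\<close>
  define N where "N = max 1 (card cells)"
  have "small_cover K N (D / 2) S"
    if S: "S \<subseteq> mspace K" and D: "0 \<le> D" "\<forall>x\<in>S. \<forall>y\<in>S. mdist K x y \<le> D" for S and D :: real
  proof (cases "D = 0 \<or> S = {}")
    case True
    then show ?thesis
      using S D unfolding small_cover_def by (intro exI[of _ "{S}"]) (auto simp: N_def)
  next
    case False
    then obtain x0 where x0: "x0 \<in> S" by blast
    define \<delta> where "\<delta> = c * (D / 2) powr \<alpha> / (d + 1)"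
    have \<delta>: "0 < \<delta>" using False D pos by (simp add: \<delta>_def)
    define k where "k x i = \<lfloor>(h x i - h x0 i) / \<delta>\<rfloor>" for x i
    define T where "T \<kappa> = {x \<in> S. \<forall>i<d. k x i = \<kappa> i}" for \<kappa>
    have "restrict (k x) {..<d} \<in> cells" if x: "x \<in> S" for x
      unfolding cells_def
    proof (rule restrict_PiE_iff[THEN iffD2], intro ballI)
      fix i assume i: "i \<in> {..<d}"
      have "\<bar>h x i - h x0 i\<bar> \<le> mdist (euclid d) (h x) (h x0)"
        using i coordinate_le_euclid by (metis lessThan_iff)
      also have "\<dots> \<le> C * mdist K x x0 powr \<alpha>" using up x x0 S by blast
      also have "\<dots> \<le> C * D powr \<alpha>"
        using D x x0 pos by (intro mult_left_mono powr_mono2) auto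
      finally have "\<bar>h x i - h x0 i\<bar> / \<delta> \<le> C * D powr \<alpha> / \<delta>"
        using \<delta> by (intro divide_right_mono) auto
      also have "\<dots> = C * (d + 1) * 2 powr \<alpha> / c"
        using pos False D by (simp add: \<delta>_def powr_divide field_simps)
      also have "\<dots> \<le> m" unfolding m_def by linarith
      finally have "\<bar>(h x i - h x0 i) / \<delta>\<bar> \<le> m" using \<delta> by simp
      then show "k x i \<in> {-m..m}" unfolding k_def atLeastAtMost_iff by linarith
    qed
    moreover have "x \<in> T (restrict (k x) {..<d})" if "x \<in> S" for x
      using that by (simp add: T_def)
    ultimately have "S \<subseteq> \<Union>(T ` cells)" by blast
    moreover have "mdist K x y \<le> D / 2" if xy: "x \<in> T \<kappa>" "y \<in> T \<kappa>" for x y \<kappa>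
    proof (rule ccontr)
      assume "\<not> mdist K x y \<le> D / 2"
      then have "(D / 2) powr \<alpha> < mdist K x y powr \<alpha>"
        using D pos by (intro powr_less_mono2) auto
      then have "c * (D / 2) powr \<alpha> < c * mdist K x y powr \<alpha>" using pos by simp
      also have "\<dots> \<le> mdist (euclid d) (h x) (h y)"
        using lo xy S by (auto simp: T_def)
      also have "\<dots> \<le> d * \<delta>"
      proof (rule euclid_le_coordinates)
        fix i assume "i < d"
        then have "k x i = k y i" using xy by (simp add: T_def)
        then have "\<bar>(h x i - h x0 i) / \<delta> - (h y i - h x0 i) / \<delta>\<bar> \<le> 1"
          unfolding k_def by linarith
        then have "\<bar>(h x i - h y i) / \<delta>\<bar> \<le> 1" by (simp add: diff_divide_distrib)
        then show "\<bar>h x i - h y i\<bar> \<le> \<delta>" using \<delta> by (simp add: abs_divide field_simps)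
      qed
      also have "\<dots> \<le> c * (D / 2) powr \<alpha>"
        using pos by (simp add: \<delta>_def field_simps)
      finally show False by simp
    qed
    moreover have "card (T ` cells) \<le> N"
      unfolding N_def using card_image_le[OF fin, of T] by linarith
    moreover have "T \<kappa> \<subseteq> mspace K" for \<kappa> using S by (auto simp: T_def)
    ultimately show ?thesis
      using fin unfolding small_cover_def by (intro exI[of _ "T ` cells"]) auto
  qed
  then show ?thesis unfolding doubling_iff_doubling_with[OF K] doubling_with_def by blast
qed

section \<open>Extending contractions to \<open>\<real>\<^sup>d\<close>\<close>

text \<open>
  The extension is the largest \<open>l\<close>-Lipschitz function below the cones \<open>x \<mapsto> f w + l * dist x w\<close>
  with apex over \<open>w \<in> L\<close>, namely their infimum.
\<close>
lemma McShane_extension: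
  fixes f :: "'a \<Rightarrow> real"
  assumes L: "L \<subseteq> mspace M" "L \<noteq> {}" and l: "0 \<le> l"
    and f: "\<And>x y. x \<in> L \<Longrightarrow> y \<in> L \<Longrightarrow> \<bar>f x - f y\<bar> \<le> l * mdist M x y"
  obtains g where "\<And>x. x \<in> L \<Longrightarrow> g x = f x"
    and "\<And>x y. x \<in> mspace M \<Longrightarrow> y \<in> mspace M \<Longrightarrow> \<bar>g x - g y\<bar> \<le> l * mdist M x y"
proof -
  define g where "g x = (INF w\<in>L. f w + l * mdist M x w)" for x
  obtain w0 where w0: "w0 \<in> L" using L by blast
  have tri: "l * mdist M x z \<le> l * mdist M x y + l * mdist M y z"
    if "x \<in> mspace M" "y \<in> mspace M" "z \<in> mspace M" for x y z
    using mult_left_mono[OF mdist_triangle[OF that] l] by (simp add: distrib_left)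
  have bdd: "bdd_below ((\<lambda>w. f w + l * mdist M x w) ` L)" if x: "x \<in> mspace M" for x
  proof (rule bdd_belowI2)
    fix w assume w: "w \<in> L"
    have "f w0 - f w \<le> l * mdist M w0 w" using f[OF w0 w] by linarith
    also have "\<dots> \<le> l * mdist M w0 x + l * mdist M x w"
      using tri L x w w0 by blast
    finally show "f w0 - l * mdist M w0 x \<le> f w + l * mdist M x w" by linarith
  qed
  have "g x = f x" if x: "x \<in> L" for x
  proof (rule antisym)
    have "g x \<le> f x + l * mdist M x x"
      unfolding g_def using x L by (intro cINF_lower bdd) auto
    also have "mdist M x x = 0" using x L by (metis mdist_zero subsetD)
    finally show "g x \<le> f x" by simp
    show "f x \<le> g x"
      unfolding g_def using L
    proof (intro cINF_greatest)
      fix w assume "w \<in> L"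
      then show "f x \<le> f w + l * mdist M x w" using f[OF x] by (smt (verit))
    qed
  qed
  moreover have half: "g x \<le> g y + l * mdist M x y" if xy: "x \<in> mspace M" "y \<in> mspace M" for x y
  proof -
    have "g x - l * mdist M x y \<le> g y"
      unfolding g_def[of y]
    proof (rule cINF_greatest[OF L(2)])
      fix w assume w: "w \<in> L"
      have "g x \<le> f w + l * mdist M x w"
        unfolding g_def using w xy by (intro cINF_lower bdd)
      also have "\<dots> \<le> f w + (l * mdist M x y + l * mdist M y w)"
        using tri xy w L by (intro add_left_mono) blast
      finally show "g x - l * mdist M x y \<le> f w + l * mdist M y w" by linarith
    qed
    then show ?thesis by linarith
  qed
  moreover have "\<bar>g x - g y\<bar> \<le> l * mdist M x y" if "x \<in> mspace M" "y \<in> mspace M" for x y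
    using half[OF that] half[OF that(2,1)] unfolding mdist_commute[of M y x] by linarith
  ultimately show ?thesis using that by blast
qed

text \<open>
  Each coordinate of \<open>g\<close> extends with the same Lipschitz constant \<open>l\<close>, and putting the \<open>d\<close>
  coordinates together costs at most a factor \<open>d\<close>, which the assumption \<open>d * l < 1\<close> absorbs.
\<close>
lemma contracting_extension_euclid:
  assumes L: "L \<subseteq> mspace (euclid d)" "L \<noteq> {}" and l: "0 \<le> l" "d * l < 1"
    and gL: "g \<in> L \<rightarrow>\<^sub>E L"
    and g: "\<And>x y. x \<in> L \<Longrightarrow> y \<in> L \<Longrightarrow> mdist (euclid d) (g x) (g y) \<le> l * mdist (euclid d) x y"
  obtains g' where "contracting (euclid d) g'" "g = restrict g' L"
proof -
  have "\<exists>F. (\<forall>x\<in>L. F x = g x i) \<and> (\<forall>x\<in>mspace (euclid d). \<forall>y\<in>mspace (euclid d).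
          \<bar>F x - F y\<bar> \<le> l * mdist (euclid d) x y)" if "i < d" for i
  proof -
    have "\<bar>g x i - g y i\<bar> \<le> l * mdist (euclid d) x y" if "x \<in> L" "y \<in> L" for x y
      using coordinate_le_euclid[OF \<open>i < d\<close>] g[OF that] order_trans by blast
    from McShane_extension[OF L l(1) this] show ?thesis by metis
  qed
  then obtain F where FL: "\<And>i x. i < d \<Longrightarrow> x \<in> L \<Longrightarrow> F i x = g x i"
    and F: "\<And>i x y. i < d \<Longrightarrow> x \<in> mspace (euclid d) \<Longrightarrow> y \<in> mspace (euclid d) \<Longrightarrow>
          \<bar>F i x - F i y\<bar> \<le> l * mdist (euclid d) x y"
    by metis
  define g' where "g' = (\<lambda>x\<in>mspace (euclid d). \<lambda>i. if i < d then F i x else 0)"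
  have "mdist (euclid d) (g' x) (g' y) \<le> d * l * mdist (euclid d) x y"
    if xy: "x \<in> mspace (euclid d)" "y \<in> mspace (euclid d)" for x y
    using euclid_le_coordinates[of d "g' x" "g' y"] F[OF _ xy] xy
    by (simp only: g'_def restrict_apply' if_True mult.assoc)
  moreover have "g' \<in> mspace (euclid d) \<rightarrow>\<^sub>E mspace (euclid d)"
    by (auto simp: g'_def)
  ultimately have "contracting (euclid d) g'"
    unfolding contracting_iff_Lipschitz using l by (intro conjI exI[of _ "d * l"]) auto
  moreover have "g = restrict g' L"
  proof
    fix x show "g x = restrict g' L x"
    proof (cases "x \<in> L")
      case True
      have "g x i = g' x i" for i
      proof (cases "i < d")
        case True
        then show ?thesis using \<open>x \<in> L\<close> L FL by (auto simp: g'_def)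
      next
        case False
        have "g x \<in> mspace (euclid d)" using gL \<open>x \<in> L\<close> L by blast
        then show ?thesis using False \<open>x \<in> L\<close> L by (auto simp: g'_def)
      qed
      then show ?thesis using True by auto
    next
      case False
      then show ?thesis using PiE_arb[OF gL False] by simp
    qed
  qed
  ultimately show ?thesis using that by blast
qed

lemma contracting_submetric:
  assumes "contracting M g'" "L \<subseteq> mspace M" "restrict g' L \<in> L \<rightarrow>\<^sub>E L"
  shows "contracting (submetric M L) (restrict g' L)"
proof -
  have "L \<inter> mspace M = L" using assms by blast
  then show ?thesis
    using assms unfolding contracting_iff_Lipschitz by (auto simp: subset_iff)
qed

section \<open>Iterated families and conjugation\<close>

lemma comp_power_Suc:
  "comp_power K F (Suc n) = {compose (mspace K) f g | f g. f \<in> F \<and> g \<in> comp_power K F n}"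
proof (intro set_eqI iffI)
  fix u assume "u \<in> comp_power K F (Suc n)"
  then obtain fs where fs: "length fs = Suc n" "set fs \<subseteq> F"
    and u: "u = foldr (compose (mspace K)) fs (restrict id (mspace K))"
    unfolding comp_power_def by blast
  then obtain f gs where "fs = f # gs" by (cases fs) auto
  then show "u \<in> {compose (mspace K) f g | f g. f \<in> F \<and> g \<in> comp_power K F n}"
    using fs u unfolding comp_power_def by auto
next
  fix u assume "u \<in> {compose (mspace K) f g | f g. f \<in> F \<and> g \<in> comp_power K F n}"
  then obtain f gs where fs: "f \<in> F" "length gs = n" "set gs \<subseteq> F"
    and u: "u = compose (mspace K) f (foldr (compose (mspace K)) gs (restrict id (mspace K)))"
    unfolding comp_power_def by blast
  then show "u \<in> comp_power K F (Suc n)"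
    unfolding comp_power_def by (intro CollectI exI[of _ "f # gs"]) auto
qed

lemma comp_power_0: "comp_power K F 0 = {restrict id (mspace K)}"
  by (auto simp: comp_power_def)

lemma finite_comp_power:
  assumes "finite F"
  shows "finite (comp_power K F n)"
proof -
  have "comp_power K F n = (\<lambda>fs. foldr (compose (mspace K)) fs (restrict id (mspace K))) `
      {fs. set fs \<subseteq> F \<and> length fs = n}"
    unfolding comp_power_def by auto
  then show ?thesis using finite_lists_length_eq[OF assms] by simp
qed

lemma comp_power_Lipschitz:
  assumes F: "\<And>f. f \<in> F \<Longrightarrow> f \<in> mspace K \<rightarrow>\<^sub>E mspace K"
    and l: "0 \<le> l"
      "\<And>f x y. f \<in> F \<Longrightarrow> x \<in> mspace K \<Longrightarrow> y \<in> mspace K \<Longrightarrow> mdist K (f x) (f y) \<le> l * mdist K x y"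
    and g: "g \<in> comp_power K F n"
  shows "g \<in> mspace K \<rightarrow>\<^sub>E mspace K \<and>
    (\<forall>x\<in>mspace K. \<forall>y\<in>mspace K. mdist K (g x) (g y) \<le> l ^ n * mdist K x y)"
  using g
proof (induction n arbitrary: g)
  case 0
  then show ?case by (auto simp: comp_power_0)
next
  case (Suc n)
  then obtain f u where fu: "f \<in> F" "u \<in> comp_power K F n" "g = compose (mspace K) f u"
    unfolding comp_power_Suc by blast
  note u = Suc.IH[OF fu(2)]
  have um: "u x \<in> mspace K" if "x \<in> mspace K" for x using u that by blast
  have "mdist K (g x) (g y) \<le> l ^ Suc n * mdist K x y"
    if xy: "x \<in> mspace K" "y \<in> mspace K" for x y
  proof -
    have "mdist K (f (u x)) (f (u y)) \<le> l * mdist K (u x) (u y)"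
      using l(2)[OF fu(1)] um xy by blast
    also have "\<dots> \<le> l * (l ^ n * mdist K x y)"
      using u xy l(1) by (intro mult_left_mono) auto
    finally show ?thesis using xy by (simp add: fu(3) compose_eq mult.assoc)
  qed
  moreover have "g \<in> mspace K \<rightarrow>\<^sub>E mspace K"
    unfolding fu(3) compose_def restrict_PiE_iff using F[OF fu(1)] um by blast
  ultimately show ?case by blast
qed

lemma comp_power_covers:
  assumes "mspace K = (\<Union>f\<in>F. f ` mspace K)"
  shows "mspace K = (\<Union>g\<in>comp_power K F n. g ` mspace K)"
proof (induction n)
  case 0
  show ?case by (simp add: comp_power_0)
next
  case (Suc n)
  have "(\<Union>g\<in>comp_power K F (Suc n). g ` mspace K)
      = (\<Union>f\<in>F. \<Union>u\<in>comp_power K F n. f ` u ` mspace K)"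
  proof (intro set_eqI iffI)
    fix y assume "y \<in> (\<Union>g\<in>comp_power K F (Suc n). g ` mspace K)"
    then obtain f u x where "f \<in> F" "u \<in> comp_power K F n" "x \<in> mspace K"
        "y = compose (mspace K) f u x"
      unfolding comp_power_Suc by blast
    then show "y \<in> (\<Union>f\<in>F. \<Union>u\<in>comp_power K F n. f ` u ` mspace K)"
      by (auto simp: compose_def)
  next
    fix y assume "y \<in> (\<Union>f\<in>F. \<Union>u\<in>comp_power K F n. f ` u ` mspace K)"
    then obtain f u x where fu: "f \<in> F" "u \<in> comp_power K F n" and x: "x \<in> mspace K"
        "y = f (u x)"
      by blast
    then have "y = compose (mspace K) f u x" by (simp add: compose_def)
    then show "y \<in> (\<Union>g\<in>comp_power K F (Suc n). g ` mspace K)"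
      using fu x unfolding comp_power_Suc by blast
  qed
  also have "\<dots> = (\<Union>f\<in>F. f ` (\<Union>u\<in>comp_power K F n. u ` mspace K))" by blast
  also have "\<dots> = mspace K" using Suc assms by simp
  finally show ?case by simp
qed

lemma metric_fractal_uniform_ratio:
  assumes "metric_fractal K F"
  obtains l :: real where "0 < l" "l < 1"
    "\<And>f x y. f \<in> F \<Longrightarrow> x \<in> mspace K \<Longrightarrow> y \<in> mspace K \<Longrightarrow> mdist K (f x) (f y) \<le> l * mdist K x y"
proof -
  have fin: "finite F" and con: "\<forall>f\<in>F. contracting K f"
    using assms by (auto simp: metric_fractal_def)
  then obtain l where l: "\<And>f. f \<in> F \<Longrightarrow> 0 \<le> l f \<and> l f < 1 \<and>
      (\<forall>x\<in>mspace K. \<forall>y\<in>mspace K. mdist K (f x) (f y) \<le> l f * mdist K x y)"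
    unfolding contracting_iff_Lipschitz by metis
  define m :: real where "m = Max (insert (1 / 2) (l ` F))"
  have "1 / 2 \<le> m" unfolding m_def using fin by (intro Max_ge) auto
  moreover have "m < 1" unfolding m_def using fin l by (subst Max_less_iff) auto
  moreover have "mdist K (f x) (f y) \<le> m * mdist K x y"
    if f: "f \<in> F" and xy: "x \<in> mspace K" "y \<in> mspace K" for f x y
  proof -
    have "l f \<le> m" unfolding m_def using fin f by (intro Max_ge) auto
    then have "l f * mdist K x y \<le> m * mdist K x y" by (intro mult_right_mono) auto
    then show ?thesis using l[OF f] xy by (meson order_trans)
  qed
  ultimately show ?thesis using that[of m] by auto
qed

text \<open>
  Conjugation by \<open>h\<close> turns the Lipschitz constant \<open>l\<close> into \<open>C / c * l powr \<alpha>\<close>: the upper Hoelder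
  bound is applied to the images and the lower one to the arguments. The smallness assumption is
  what the extension to all of \<open>\<real>\<^sup>d\<close> needs; contractivity on \<open>L\<close> itself follows by restricting the
  extension.
\<close>
lemma conjugate_fractal_in_euclid:
  assumes K: "compact_space (mtopology_of K)" "mspace K \<noteq> {}"
    and hL: "h ` mspace K = L" and LM: "L \<subseteq> mspace (euclid d)"
    and pos: "0 < c" "0 < C" "0 < \<alpha>"
    and lo: "\<And>x y. x \<in> mspace K \<Longrightarrow> y \<in> mspace K \<Longrightarrow>
               c * mdist K x y powr \<alpha> \<le> mdist (euclid d) (h x) (h y)"
    and up: "\<And>x y. x \<in> mspace K \<Longrightarrow> y \<in> mspace K \<Longrightarrow>
               mdist (euclid d) (h x) (h y) \<le> C * mdist K x y powr \<alpha>"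
    and F: "finite F" "mspace K = (\<Union>f\<in>F. f ` mspace K)"
    and Fl: "\<And>f. f \<in> F \<Longrightarrow> f \<in> mspace K \<rightarrow>\<^sub>E mspace K"
      "0 \<le> l" "\<And>f x y. f \<in> F \<Longrightarrow> x \<in> mspace K \<Longrightarrow> y \<in> mspace K \<Longrightarrow>
         mdist K (f x) (f y) \<le> l * mdist K x y"
    and small: "d * (C / c * l powr \<alpha>) < 1"
  shows "fractal_in (euclid d) L {restrict (h \<circ> f \<circ> inv_into (mspace K) h) L | f. f \<in> F}"
    (is "fractal_in _ _ ?G")
proof -
  have eq: "equi_Hoelder_homeomorphism K (submetric (euclid d) L) h"
    by (rule Hoelder_imp_equi_Hoelder_homeomorphism[OF K(1) hL LM pos lo up])
  then have hom: "homeomorphic_map (mtopology_of K) (mtopology_of (submetric (euclid d) L)) h"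
    unfolding equi_Hoelder_homeomorphism_def by blast
  have inj: "inj_on h (mspace K)"
    using homeomorphic_imp_injective_map[OF hom] by simp
  have mL: "mspace (submetric (euclid d) L) = L"
    using LM by (simp only: mspace_submetric) blast
  have Lne: "L \<noteq> {}" using K hL by blast
  have comp: "compact_space (mtopology_of (submetric (euclid d) L))"
    using hom K(1) homeomorphic_compact_space homeomorphic_map_imp_homeomorphic_space by blast
  define conj where "conj f = restrict (h \<circ> f \<circ> inv_into (mspace K) h) L" for f
  have conj_h: "conj f (h x) = h (f x)" if "x \<in> mspace K" for f x
    using that inj hL by (auto simp: conj_def)
  have conjL: "conj f \<in> L \<rightarrow>\<^sub>E L" if "f \<in> F" for f
  proof (rule PiE_I)
    fix z assume "z \<in> L"
    then obtain x where "x \<in> mspace K" "z = h x" using hL by blast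
    then show "conj f z \<in> L" using conj_h[of x f] Fl(1)[OF that] hL by auto
  qed (simp add: conj_def)
  have conj_lip: "mdist (euclid d) (conj f z) (conj f w) \<le> (C / c * l powr \<alpha>) * mdist (euclid d) z w"
    if f: "f \<in> F" and zw: "z \<in> L" "w \<in> L" for f z w
  proof -
    obtain x y where xy: "x \<in> mspace K" "z = h x" "y \<in> mspace K" "w = h y" using zw hL by blast
    have fm: "f x \<in> mspace K" "f y \<in> mspace K" using Fl(1)[OF f] xy by auto
    have "mdist (euclid d) (conj f z) (conj f w) \<le> C * mdist K (f x) (f y) powr \<alpha>"
      using up[OF fm] xy conj_h by simp
    also have "\<dots> \<le> C * (l * mdist K x y) powr \<alpha>"
      using Fl(3)[OF f] xy pos by (intro mult_left_mono powr_mono2) auto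
    also have "\<dots> = (C / c * l powr \<alpha>) * (c * mdist K x y powr \<alpha>)"
      using pos Fl(2) by (simp add: powr_mult)
    also have "\<dots> \<le> (C / c * l powr \<alpha>) * mdist (euclid d) z w"
      using lo xy pos by (intro mult_left_mono) auto
    finally show ?thesis .
  qed
  have ext: "\<exists>g'. contracting (euclid d) g' \<and> conj f = restrict g' L" if f: "f \<in> F" for f
  proof -
    have "0 \<le> C / c * l powr \<alpha>" using pos by simp
    from contracting_extension_euclid[OF LM Lne this small conjL[OF f] conj_lip[OF f]]
    show ?thesis by blast
  qed
  have con: "contracting (submetric (euclid d) L) (conj f)" if f: "f \<in> F" for f
    using ext[OF f] contracting_submetric[OF _ LM] conjL[OF f] by metis
  have cov: "L = (\<Union>f\<in>F. conj f ` L)"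
  proof -
    have "conj f ` L = h ` f ` mspace K" for f
      unfolding hL[symmetric] image_image using conj_h by simp
    then have "(\<Union>f\<in>F. conj f ` L) = h ` (\<Union>f\<in>F. f ` mspace K)" by (simp add: image_UN)
    then show ?thesis using F(2) hL by simp
  qed
  have G: "?G = conj ` F" by (auto simp: conj_def)
  have "metric_fractal (submetric (euclid d) L) (conj ` F)"
    unfolding metric_fractal_def mL ball_simps image_image UN_simps
    using Lne comp F(1) con cov by (intro conjI) simp_all
  then show ?thesis
    unfolding G fractal_in_def using mcomplete_euclid LM ext by blast
qed

section \<open>Series with a geometric peak\<close>

text \<open>
  On either side of the index \<open>I\<close> the series is dominated by \<open>B * (1 / 128) ^ k\<close>, \<open>k \<ge> 1\<close>, with
  sum \<open>B / 127\<close>. Together this is less than \<open>B / 32\<close>, half of the lower bound \<open>B / 16\<close> for the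
  term at \<open>I\<close> that a pair of distinguished points will provide.
\<close>
lemma suminf_near_peak:
  fixes b :: "nat \<Rightarrow> real"
  assumes b: "\<And>i. \<bar>b i\<bar> \<le> B * (1 / 128) ^ ((i - I) + (I - i))"
  shows "summable b" "\<bar>suminf b - b I\<bar> \<le> B / 32" "\<bar>suminf b\<bar> \<le> 2 * B"
proof -
  define g :: "nat \<Rightarrow> real" where "g k = B * (1 / 128) ^ Suc k" for k
  have B: "0 \<le> B" using b[of I] by simp
  have "(\<lambda>k. (B / 128) * (1 / 128) ^ k) sums ((B / 128) * (1 / (1 - 1 / 128)))"
    by (intro sums_mult geometric_sums) simp
  moreover have "g = (\<lambda>k. (B / 128) * (1 / 128) ^ k)" by (simp add: g_def fun_eq_iff)
  ultimately have g: "g sums (B / 127)" by simp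
  have up: "\<bar>b (j + Suc I)\<bar> \<le> g j" for j
    using b[of "j + Suc I"] by (simp add: g_def)
  have "summable (\<lambda>j. b (j + Suc I))"
    using up by (intro summable_comparison_test'[OF sums_summable[OF g], of 0]) simp
  then show sb: "summable b" by (simp only: summable_iff_shift)
  have "\<bar>\<Sum>j. b (j + Suc I)\<bar> \<le> (\<Sum>j. \<bar>b (j + Suc I)\<bar>)"
    using up by (intro summable_rabs summable_comparison_test'[OF sums_summable[OF g], of 0]) simp
  also have "\<dots> \<le> suminf g"
    using up by (intro suminf_le summable_comparison_test'[OF sums_summable[OF g], of 0]
        sums_summable[OF g]) simp_all
  finally have tail: "\<bar>\<Sum>j. b (j + Suc I)\<bar> \<le> B / 127" using g by (simp add: sums_iff)
  have "\<bar>\<Sum>i<I. b i\<bar> \<le> (\<Sum>i<I. g (I - Suc i))"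
  proof (rule sum_abs[THEN order_trans], rule sum_mono)
    fix i assume "i \<in> {..<I}"
    then have "(i - I) + (I - i) = Suc (I - Suc i)" by auto
    then show "\<bar>b i\<bar> \<le> g (I - Suc i)" using b[of i] by (simp only: g_def)
  qed
  also have "\<dots> = (\<Sum>i<I. g i)" by (rule sum.nat_diff_reindex)
  also have "\<dots> \<le> suminf g"
    using B by (intro sum_le_suminf sums_summable[OF g]) (auto simp: g_def)
  finally have head: "\<bar>\<Sum>i<I. b i\<bar> \<le> B / 127" using g by (simp add: sums_iff)
  have "suminf b = (\<Sum>j. b (j + Suc I)) + (\<Sum>i<Suc I. b i)"
    by (rule suminf_split_initial_segment[OF sb])
  then have "suminf b - b I = (\<Sum>j. b (j + Suc I)) + (\<Sum>i<I. b i)" by simp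
  then show *: "\<bar>suminf b - b I\<bar> \<le> B / 32" using head tail B by linarith
  have "\<bar>b I\<bar> \<le> B" using b[of I] by simp
  then show "\<bar>suminf b\<bar> \<le> 2 * B" using * B by linarith
qed

section \<open>Separated sets in doubling spaces\<close>

lemma small_cover_trans:
  assumes S: "small_cover M n e S"
    and T: "\<And>T. T \<subseteq> mspace M \<Longrightarrow> (\<forall>x\<in>T. \<forall>y\<in>T. mdist M x y \<le> e) \<Longrightarrow> small_cover M N e' T"
  shows "small_cover M (n * N) e' S"
proof -
  obtain \<T> where \<T>: "finite \<T>" "card \<T> \<le> n" "S \<subseteq> \<Union>\<T>"
      "\<forall>T\<in>\<T>. T \<subseteq> mspace M \<and> (\<forall>x\<in>T. \<forall>y\<in>T. mdist M x y \<le> e)"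
    using S unfolding small_cover_def by (elim exE conjE)
  have "\<forall>T\<in>\<T>. small_cover M N e' T"
  proof
    fix X assume "X \<in> \<T>"
    with \<T>(4) have "X \<subseteq> mspace M \<and> (\<forall>x\<in>X. \<forall>y\<in>X. mdist M x y \<le> e)" ..
    then show "small_cover M N e' X" by (elim conjE) (rule T)
  qed
  then have "\<exists>U. \<forall>T\<in>\<T>. finite (U T) \<and> card (U T) \<le> N \<and> T \<subseteq> \<Union>(U T) \<and>
      (\<forall>V\<in>U T. V \<subseteq> mspace M \<and> (\<forall>x\<in>V. \<forall>y\<in>V. mdist M x y \<le> e'))"
    unfolding small_cover_def by (rule bchoice)
  then obtain U where U: "\<forall>T\<in>\<T>. finite (U T) \<and> card (U T) \<le> N \<and> T \<subseteq> \<Union>(U T) \<and>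
      (\<forall>V\<in>U T. V \<subseteq> mspace M \<and> (\<forall>x\<in>V. \<forall>y\<in>V. mdist M x y \<le> e'))" ..
  have U1: "finite (U T)" "card (U T) \<le> N" "T \<subseteq> \<Union>(U T)" if "T \<in> \<T>" for T
    using bspec[OF U that] by simp_all
  have U2: "V \<subseteq> mspace M \<and> (\<forall>x\<in>V. \<forall>y\<in>V. mdist M x y \<le> e')" if "T \<in> \<T>" "V \<in> U T" for T V
    using bspec[OF U that(1)] that(2) by simp
  have "card (\<Union>T\<in>\<T>. U T) \<le> (\<Sum>T\<in>\<T>. card (U T))"
    by (rule card_UN_le[OF \<T>(1)])
  also have "\<dots> \<le> (\<Sum>T\<in>\<T>. N)" using U1(2) by (intro sum_mono)
  also have "\<dots> \<le> n * N" using \<T>(2) by simp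
  finally have "card (\<Union>T\<in>\<T>. U T) \<le> n * N" .
  moreover have "finite (\<Union>T\<in>\<T>. U T)" using \<T>(1) U1(1) by (rule finite_UN_I)
  moreover have "S \<subseteq> \<Union>(\<Union>T\<in>\<T>. U T)"
  proof
    fix x assume "x \<in> S"
    then obtain T where "T \<in> \<T>" "x \<in> T" using \<T>(3) by (meson UnionE subsetD)
    then show "x \<in> \<Union>(\<Union>T\<in>\<T>. U T)" using U1(3)[of T] by blast
  qed
  moreover have "\<forall>V\<in>(\<Union>T\<in>\<T>. U T). V \<subseteq> mspace M \<and> (\<forall>x\<in>V. \<forall>y\<in>V. mdist M x y \<le> e')"
    using U2 by (intro ballI) (elim UN_E)
  ultimately show ?thesis
    unfolding small_cover_def by (intro exI[of _ "\<Union>T\<in>\<T>. U T"] conjI)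
qed

lemma card_separated_le_small_cover:
  assumes S: "small_cover M n e S" and P: "P \<subseteq> S"
    and sep: "\<And>p q. p \<in> P \<Longrightarrow> q \<in> P \<Longrightarrow> p \<noteq> q \<Longrightarrow> e < mdist M p q"
  shows "finite P" "card P \<le> n"
proof -
  obtain \<T> where \<T>: "finite \<T>" "card \<T> \<le> n" "S \<subseteq> \<Union>\<T>"
      "\<forall>T\<in>\<T>. T \<subseteq> mspace M \<and> (\<forall>x\<in>T. \<forall>y\<in>T. mdist M x y \<le> e)"
    using S unfolding small_cover_def by (elim exE conjE)
  have "\<forall>p\<in>P. \<exists>T. T \<in> \<T> \<and> p \<in> T"
    using \<T>(3) P by auto
  from bchoice[OF this] obtain u where u: "\<forall>p\<in>P. u p \<in> \<T> \<and> p \<in> u p" ..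
  have inj: "inj_on u P"
  proof (rule inj_onI, rule ccontr)
    fix p q assume pq: "p \<in> P" "q \<in> P" "u p = u q" "p \<noteq> q"
    then have "u p \<in> \<T>" "p \<in> u p" "q \<in> u p" using u by auto
    then have "mdist M p q \<le> e" using \<T>(4) by simp
    then show False using sep[OF pq(1,2,4)] by simp
  qed
  have im: "u ` P \<subseteq> \<T>" using u by auto
  show "finite P" using finite_subset[OF im \<T>(1)] inj by (rule finite_imageD)
  show "card P \<le> n" using card_inj_on_le[OF inj im \<T>(1)] \<T>(2) by linarith
qed

lemma doubling_with_iterate:
  assumes N: "doubling_with N M" and S: "S \<subseteq> mspace M"
    and D: "0 \<le> D" "\<forall>x\<in>S. \<forall>y\<in>S. mdist M x y \<le> D"
  shows "small_cover M (N ^ k) (D / 2 ^ k) S"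
proof (induction k)
  case 0
  show ?case
    unfolding small_cover_def using S D by (intro exI[of _ "{S}"]) simp
next
  case (Suc k)
  have "small_cover M (N ^ k * N) (D / 2 ^ k / 2) S"
  proof (rule small_cover_trans[OF Suc])
    fix T assume "T \<subseteq> mspace M" "\<forall>x\<in>T. \<forall>y\<in>T. mdist M x y \<le> D / 2 ^ k"
    moreover from D have "0 \<le> D / 2 ^ k" by simp
    moreover note N[unfolded doubling_with_def, THEN spec[of _ T], THEN spec[of _ "D / 2 ^ k"]]
    ultimately show "small_cover M N (D / 2 ^ k / 2) T" by (simp only: simp_thms)
  qed
  then show ?case by (simp add: mult.commute)
qed

text \<open>
  Halving the diameter \<open>k\<close> times gives \<open>N ^ k\<close> sets of diameter less than \<open>t\<close>, each of which
  contains at most one point of a \<open>t\<close>-separated set.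
\<close>
lemma doubling_with_card_separated:
  assumes N: "doubling_with N M" and P: "P \<subseteq> mspace M"
    and D: "\<And>p q. p \<in> P \<Longrightarrow> q \<in> P \<Longrightarrow> mdist M p q \<le> D" and t: "D < 2 ^ k * t" "0 < t"
    and sep: "\<And>p q. p \<in> P \<Longrightarrow> q \<in> P \<Longrightarrow> p \<noteq> q \<Longrightarrow> t \<le> mdist M p q"
  shows "finite P" "card P \<le> N ^ k"
proof -
  have *: "small_cover M (N ^ k) (max D 0 / 2 ^ k) P"
    by (rule doubling_with_iterate[OF N P]) (use D in \<open>auto intro: max.coboundedI1\<close>)
  have "max D 0 < 2 ^ k * t" using t by simp
  then have "max D 0 / 2 ^ k < t" by (simp add: divide_less_eq mult.commute)
  then have "max D 0 / 2 ^ k < mdist M p q" if "p \<in> P" "q \<in> P" "p \<noteq> q" for p q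
    using sep[OF that] by linarith
  from card_separated_le_small_cover[OF * order_refl this]
  show "finite P" "card P \<le> N ^ k" by simp_all
qed

text \<open>
  The cardinality of \<open>t\<close>-separated subsets is bounded, so one of maximal cardinality exists; a
  point at distance at least \<open>t\<close> from all its members could be added to it.
\<close>
lemma exists_separated_net:
  assumes N: "doubling_with N M" and t: "0 < t"
    and bd: "\<forall>x\<in>mspace M. \<forall>y\<in>mspace M. mdist M x y \<le> D"
  shows "\<exists>P. finite P \<and> P \<subseteq> mspace M \<and> (\<forall>p\<in>P. \<forall>q\<in>P. p \<noteq> q \<longrightarrow> t \<le> mdist M p q) \<and>
    (\<forall>x\<in>mspace M. \<exists>p\<in>P. mdist M x p < t)"
proof -
  define sep where "sep P \<longleftrightarrow> P \<subseteq> mspace M \<and> (\<forall>p\<in>P. \<forall>q\<in>P. p \<noteq> q \<longrightarrow> t \<le> mdist M p q)" for P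
  obtain k where k: "D / t < 2 ^ k"
    using real_arch_pow[of 2 "D / t"] by auto
  have fin: "finite P \<and> card P \<le> N ^ k" if "sep P" for P
  proof -
    have PM: "P \<subseteq> mspace M" and Pt: "\<And>p q. p \<in> P \<Longrightarrow> q \<in> P \<Longrightarrow> p \<noteq> q \<Longrightarrow> t \<le> mdist M p q"
      using that by (simp_all add: sep_def)
    have PD: "mdist M p q \<le> D" if "p \<in> P" "q \<in> P" for p q
      using bd PM that by (simp add: subsetD)
    have "D < 2 ^ k * t" using k t by (simp add: divide_less_eq)
    from doubling_with_card_separated[OF N PM PD this t Pt] show ?thesis by simp
  qed
  have "sep {}" by (simp add: sep_def)
  moreover have "\<forall>P. sep P \<longrightarrow> card P < Suc (N ^ k)" using fin by (simp add: less_Suc_eq_le)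
  ultimately have "\<exists>P. sep P \<and> (\<forall>Q. sep Q \<longrightarrow> card Q \<le> card P)"
    by (rule Lattices_Big.ex_has_greatest_nat)
  then obtain P where P: "sep P" and mx: "\<forall>Q. sep Q \<longrightarrow> card Q \<le> card P" by (elim exE conjE)
  have "\<exists>p\<in>P. mdist M x p < t" if x: "x \<in> mspace M" for x
  proof (rule ccontr)
    assume no: "\<not> (\<exists>p\<in>P. mdist M x p < t)"
    have "mdist M x x = 0" using x by simp
    then have "x \<notin> P" using no t by auto
    have far: "t \<le> mdist M x p" "t \<le> mdist M p x" if "p \<in> P" for p
      using no that by (simp_all add: not_less mdist_commute)
    have "sep (insert x P)"
      using P x far by (simp add: sep_def)
    then have "card (insert x P) \<le> card P" using mx by simp
    then show False using \<open>x \<notin> P\<close> fin[OF P] by simp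
  qed
  then show ?thesis using P fin[OF P] unfolding sep_def by (intro exI[of _ P]) simp
qed

text \<open>
  Colouring the points one after the other, a new point has fewer than \<open>m\<close> neighbours, so one of
  the \<open>m\<close> colours is free for it.
\<close>
lemma greedy_colouring:
  assumes "finite A"
    and deg: "\<And>p. p \<in> A \<Longrightarrow> card {q \<in> A. R p q} < m"
    and sym: "\<And>p q. R p q \<Longrightarrow> R q p"
  shows "\<exists>col :: 'a \<Rightarrow> nat. (\<forall>p\<in>A. col p < m) \<and> (\<forall>p\<in>A. \<forall>q\<in>A. p \<noteq> q \<longrightarrow> R p q \<longrightarrow> col p \<noteq> col q)"
  using assms(1) deg
proof (induction A rule: finite_induct)
  case empty
  then show ?case by simp
next
  case (insert p A)
  have deg: "card {q \<in> A. R p' q} < m" if "p' \<in> A" for p'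
  proof -
    have "card {q \<in> A. R p' q} \<le> card {q \<in> insert p A. R p' q}"
      using insert.hyps by (intro card_mono) auto
    then show ?thesis using insert.prems[of p'] that by simp
  qed
  have "\<exists>col :: 'a \<Rightarrow> nat. (\<forall>p\<in>A. col p < m) \<and>
      (\<forall>p\<in>A. \<forall>q\<in>A. p \<noteq> q \<longrightarrow> R p q \<longrightarrow> col p \<noteq> col q)"
    by (rule insert.IH) (rule deg)
  then obtain col :: "'a \<Rightarrow> nat" where
    col: "\<forall>p\<in>A. col p < m" "\<forall>p\<in>A. \<forall>q\<in>A. p \<noteq> q \<longrightarrow> R p q \<longrightarrow> col p \<noteq> col q"
    by (elim exE conjE)
  define B where "B = {q \<in> A. R p q}"
  have "card (col ` B) \<le> card B" using insert.hyps by (intro card_image_le) (simp add: B_def)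
  also have "\<dots> \<le> card {q \<in> insert p A. R p q}"
    using insert.hyps unfolding B_def by (intro card_mono) auto
  also have "\<dots> < m" using insert.prems by simp
  finally have "card (col ` B) < m" .
  moreover have "finite (col ` B)" using insert.hyps by (simp add: B_def)
  ultimately have "\<not> {..<m} \<subseteq> col ` B"
    using card_mono[of "col ` B" "{..<m}"] by fastforce
  then obtain c where c: "c < m" "c \<notin> col ` B" by blast
  have "\<forall>q\<in>insert p A. (col(p := c)) q < m" using col(1) c by simp
  moreover have "(col(p := c)) u \<noteq> (col(p := c)) v"
    if "u \<in> insert p A" "v \<in> insert p A" "u \<noteq> v" "R u v" for u v
    using that col(2) c(2) sym[of u v] by (auto simp: B_def)
  ultimately show ?case by (intro exI[of _ "col(p := c)"]) simp
qed

section \<open>Assouad's embedding\<close>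

text \<open>
  \<open>\<psi> c\<close> is the distance to the points of colour \<open>c\<close> in a \<open>t\<close>-net, cut off at \<open>2 * t\<close>. Let \<open>p\<close> be a
  net point closer than \<open>t\<close> to \<open>x\<close>, and let \<open>c\<close> be its colour, so \<open>\<psi> c x < t\<close>. If \<open>\<psi> c y < 2 * t\<close>,
  then some net point \<open>q\<close> of colour \<open>c\<close> is closer than \<open>2 * t\<close> to \<open>y\<close>, hence closer than
  \<open>t + 16 * t + 2 * t = 19 * t\<close> to \<open>p\<close>. Equally coloured points being at least \<open>19 * t\<close> apart,
  \<open>q = p\<close>, which is impossible since \<open>y\<close> is more than \<open>3 * t\<close> away from \<open>p\<close>. The exponent \<open>6\<close> in
  the number of colours comes from \<open>38 < 2 ^ 6\<close>, where \<open>38 * t\<close> bounds the diameter of a ball of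
  radius \<open>19 * t\<close>.
\<close>
lemma distinguishing_functions_at_scale:
  assumes N: "doubling_with N M" and t: "0 < t"
    and bd: "\<forall>x\<in>mspace M. \<forall>y\<in>mspace M. mdist M x y \<le> D"
  shows "\<exists>\<psi> :: nat \<Rightarrow> 'a \<Rightarrow> real. (\<forall>c x. 0 \<le> \<psi> c x \<and> \<psi> c x \<le> 2 * t) \<and>
    (\<forall>c. \<forall>x\<in>mspace M. \<forall>y\<in>mspace M. \<bar>\<psi> c x - \<psi> c y\<bar> \<le> mdist M x y) \<and>
    (\<forall>x\<in>mspace M. \<forall>y\<in>mspace M. 4 * t \<le> mdist M x y \<longrightarrow> mdist M x y \<le> 16 * t \<longrightarrow>
       (\<exists>c \<le> N ^ 6. t \<le> \<bar>\<psi> c x - \<psi> c y\<bar>))"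
proof -
  obtain P where P: "finite P" "P \<subseteq> mspace M"
    and sep: "\<forall>p\<in>P. \<forall>q\<in>P. p \<noteq> q \<longrightarrow> t \<le> mdist M p q"
    and net: "\<forall>x\<in>mspace M. \<exists>p\<in>P. mdist M x p < t"
    using exists_separated_net[OF N t bd] by (elim exE conjE)
  have "card {q \<in> P. mdist M p q < 19 * t} < Suc (N ^ 6)" if p: "p \<in> P" for p
  proof -
    define Q where "Q = {q \<in> P. mdist M p q < 19 * t}"
    have QM: "Q \<subseteq> mspace M" and Qsep: "\<And>q r. q \<in> Q \<Longrightarrow> r \<in> Q \<Longrightarrow> q \<noteq> r \<Longrightarrow> t \<le> mdist M q r"
      using P(2) sep by (auto simp: Q_def)
    have pM: "p \<in> mspace M" using p P(2) by (rule subsetD[rotated])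
    have QD: "mdist M q r \<le> 38 * t" if q: "q \<in> Q" and r: "r \<in> Q" for q r
    proof -
      have "mdist M q r \<le> mdist M q p + mdist M p r"
        by (rule mdist_triangle[OF subsetD[OF QM q] pM subsetD[OF QM r]])
      moreover have "mdist M p q < 19 * t" "mdist M p r < 19 * t" using q r by (simp_all add: Q_def)
      ultimately show ?thesis unfolding mdist_commute[of M q p] by linarith
    qed
    have "38 * t < 2 ^ 6 * t" using t by simp
    from doubling_with_card_separated(2)[OF N QM QD this t Qsep]
    have "card Q \<le> N ^ 6" by simp
    then show ?thesis by (simp only: Q_def less_Suc_eq_le)
  qed
  then have "\<exists>col :: 'a \<Rightarrow> nat. (\<forall>p\<in>P. col p < Suc (N ^ 6)) \<and>
      (\<forall>p\<in>P. \<forall>q\<in>P. p \<noteq> q \<longrightarrow> mdist M p q < 19 * t \<longrightarrow> col p \<noteq> col q)"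
    by (rule greedy_colouring[OF P(1)]) (simp_all add: mdist_commute)
  then obtain col :: "'a \<Rightarrow> nat" where col: "\<forall>p\<in>P. col p < Suc (N ^ 6)"
    and proper: "\<forall>p\<in>P. \<forall>q\<in>P. p \<noteq> q \<longrightarrow> mdist M p q < 19 * t \<longrightarrow> col p \<noteq> col q"
    by (elim exE conjE)
  define V where "V c x = insert (2 * t) (mdist M x ` {p \<in> P. col p = c})" for c x
  define \<psi> where "\<psi> c x = Min (V c x)" for c x
  have finV: "finite (V c x)" "V c x \<noteq> {}" for c x using P(1) by (auto simp: V_def)
  have \<psi>_le: "\<psi> c x \<le> v" if "v \<in> V c x" for c x v
    unfolding \<psi>_def using finV that by simp
  have \<psi>_in: "\<psi> c x \<in> V c x" for c x
    unfolding \<psi>_def using finV by (rule Min_in)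
  have nonneg: "0 \<le> \<psi> c x" for c x
    using \<psi>_in[of c x] t by (auto simp: V_def)
  have le2t: "\<psi> c x \<le> 2 * t" for c x
    by (rule \<psi>_le) (simp add: V_def)
  have half: "\<psi> c x \<le> \<psi> c y + mdist M x y" if xy: "x \<in> mspace M" "y \<in> mspace M" for c x y
    using \<psi>_in[of c y] unfolding V_def
  proof
    assume "\<psi> c y = 2 * t"
    then show ?thesis using le2t[of c x] mdist_nonneg[of M x y] by linarith
  next
    assume "\<psi> c y \<in> mdist M y ` {p \<in> P. col p = c}"
    then obtain p where p: "p \<in> P" "col p = c" "\<psi> c y = mdist M y p" by blast
    have "\<psi> c x \<le> mdist M x p" using p by (intro \<psi>_le) (simp add: V_def)
    also have "\<dots> \<le> mdist M x y + mdist M y p" using xy p P(2) by (intro mdist_triangle) auto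
    finally show ?thesis using p by simp
  qed
  have lip: "\<bar>\<psi> c x - \<psi> c y\<bar> \<le> mdist M x y" if "x \<in> mspace M" "y \<in> mspace M" for c x y
    using half[OF that, of c] half[OF that(2,1), of c] unfolding mdist_commute[of M y x] by linarith
  have "\<exists>c \<le> N ^ 6. t \<le> \<bar>\<psi> c x - \<psi> c y\<bar>"
    if xy: "x \<in> mspace M" "y \<in> mspace M" and lo: "4 * t \<le> mdist M x y" and up: "mdist M x y \<le> 16 * t"
    for x y
  proof -
    obtain p where p: "p \<in> P" "mdist M x p < t" using bspec[OF net xy(1)] by (elim bexE conjE)
    have pM: "p \<in> mspace M" using P(2) p(1) by (rule subsetD)
    have "\<psi> (col p) x \<le> mdist M x p" using p by (intro \<psi>_le) (simp add: V_def)
    moreover have "2 * t \<le> \<psi> (col p) y"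
      using \<psi>_in[of "col p" y] unfolding V_def
    proof
      assume "\<psi> (col p) y \<in> mdist M y ` {q \<in> P. col q = col p}"
      then obtain q where q: "q \<in> P" "col q = col p" "\<psi> (col p) y = mdist M y q" by blast
      have qM: "q \<in> mspace M" using P(2) q(1) by (rule subsetD)
      have 1: "mdist M x y \<le> mdist M x p + mdist M p y" and 2: "mdist M p q \<le> mdist M p x + mdist M x q"
        and 3: "mdist M x q \<le> mdist M x y + mdist M y q"
        using xy pM qM by (simp_all add: mdist_triangle)
      show ?thesis
      proof (rule ccontr)
        assume "\<not> ?thesis"
        then have yq: "mdist M y q < 2 * t" using q by simp
        have "mdist M p q < 19 * t"
          using 2 3 yq up p(2) mdist_commute[of M p x] by linarith
        then have "p = q" using bspec[OF bspec[OF proper p(1)] q(1)] q(2) by auto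
        then have "mdist M y p < 2 * t" using yq by simp
        then show False using 1 lo p(2) mdist_commute[of M p y] t by linarith
      qed
    qed simp
    ultimately have "t \<le> \<bar>\<psi> (col p) x - \<psi> (col p) y\<bar>" using p(2) by linarith
    then show ?thesis using bspec[OF col p(1)] by (intro exI[of _ "col p"]) simp
  qed
  with nonneg le2t lip show ?thesis by (intro exI[of _ \<psi>]) simp
qed

lemma scale_of_distance:
  fixes r \<tau> :: real
  assumes "0 < r" "r \<le> 16 * \<tau>"
  obtains J where "4 * (\<tau> / 4 ^ J) < r" "r \<le> 16 * (\<tau> / 4 ^ J)"
proof -
  obtain n where n: "4 * \<tau> / r < 4 ^ n" using real_arch_pow[of 4 "4 * \<tau> / r"] by auto
  then have n: "4 * (\<tau> / 4 ^ n) < r" using assms by (simp add: field_simps)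
  define J where "J = (LEAST n. 4 * (\<tau> / 4 ^ n) < r)"
  have J: "4 * (\<tau> / 4 ^ J) < r" unfolding J_def by (rule LeastI[of _ n]) (rule n)
  moreover have "r \<le> 16 * (\<tau> / 4 ^ J)"
  proof (cases J)
    case 0
    then show ?thesis using assms by simp
  next
    case (Suc j)
    then have "\<not> 4 * (\<tau> / 4 ^ j) < r" unfolding J_def using not_less_Least by (metis lessI)
    then show ?thesis using Suc by simp
  qed
  ultimately show ?thesis using that by blast
qed

text \<open>
  The remainders modulo \<open>7\<close> can bring two indices closer together by at most \<open>6\<close>, compared with
  seven times the difference of their quotients. Truncated subtraction in both directions
  expresses the absolute difference.
\<close>
lemma residue_distance_le:
  fixes s j i I :: nat
  assumes "s < 7" "j < 7"
  shows "7 * ((i - I) + (I - i)) \<le> ((s + 7 * i) - (j + 7 * I)) + ((j + 7 * I) - (s + 7 * i)) + 6"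
proof (cases "i \<le> I")
  case True
  then obtain r where "I = i + r" using le_Suc_ex by blast
  then show ?thesis using assms by simp
next
  case False
  then obtain r where "i = I + r" using nat_le_linear le_Suc_ex by blast
  then show ?thesis using assms by simp
qed

text \<open>
  The coordinates are indexed by pairs of a residue class \<open>s < 7\<close> of scales and a colour \<open>c\<close>,
  encoded as \<open>n = s + 7 * c\<close>. The weight \<open>2 ^ j\<close> is \<open>1 / sqrt t\<^sub>j\<close> up to the constant factor
  \<open>sqrt \<tau>\<close>. For points at a distance between \<open>4 * t\<^sub>J\<close> and \<open>16 * t\<^sub>J\<close>, the summand at scale \<open>j\<close>
  changes by at most \<open>S / 2 ^ \<bar>j - J\<bar>\<close> with \<open>S = 16 * \<tau> / 2 ^ J\<close>: for \<open>j \<ge> J\<close> because it is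
  bounded by \<open>2 * \<tau> / 2 ^ j\<close>, for \<open>j < J\<close> because it is \<open>2 ^ j\<close>-Lipschitz. The distinguishing
  summand changes by at least \<open>S / 16\<close>, and the others in its residue class together by at most
  \<open>S / 32\<close>. Finally \<open>S\<close> is comparable to the square root of the distance.
\<close>
theorem Assouad_snowflake_embedding:
  assumes N: "doubling_with N K" and bd: "0 < B"
    "\<forall>x\<in>mspace K. \<forall>y\<in>mspace K. mdist K x y \<le> B"
  shows "\<exists>d (h :: 'a \<Rightarrow> nat \<Rightarrow> real) c C. 0 < c \<and> 0 < C \<and> (\<forall>x. h x \<in> mspace (euclid d)) \<and>
    (\<forall>x\<in>mspace K. \<forall>y\<in>mspace K.
       c * mdist K x y powr (1 / 2) \<le> mdist (euclid d) (h x) (h y) \<and>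
       mdist (euclid d) (h x) (h y) \<le> C * mdist K x y powr (1 / 2))"
proof -
  \<comment> \<open>With this choice every distance in \<open>K\<close> is at most 16 times the coarsest scale.\<close>
  define \<tau> where "\<tau> = B / 16"
  have \<tau>: "0 < \<tau>" using bd by (simp add: \<tau>_def)
  define M where "M = Suc (N ^ 6)"
  define d where "d = 7 * M"
  have "\<forall>j. \<exists>\<psi> :: nat \<Rightarrow> 'a \<Rightarrow> real. (\<forall>c x. 0 \<le> \<psi> c x \<and> \<psi> c x \<le> 2 * (\<tau> / 4 ^ j)) \<and>
      (\<forall>c. \<forall>x\<in>mspace K. \<forall>y\<in>mspace K. \<bar>\<psi> c x - \<psi> c y\<bar> \<le> mdist K x y) \<and>
      (\<forall>x\<in>mspace K. \<forall>y\<in>mspace K. 4 * (\<tau> / 4 ^ j) \<le> mdist K x y \<longrightarrow>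
         mdist K x y \<le> 16 * (\<tau> / 4 ^ j) \<longrightarrow>
         (\<exists>c \<le> N ^ 6. \<tau> / 4 ^ j \<le> \<bar>\<psi> c x - \<psi> c y\<bar>))"
    using \<tau> by (intro allI distinguishing_functions_at_scale[OF N _ bd(2)]) simp
  from choice[OF this] obtain \<psi> :: "nat \<Rightarrow> nat \<Rightarrow> 'a \<Rightarrow> real" where
    \<psi>: "\<forall>j. (\<forall>c x. 0 \<le> \<psi> j c x \<and> \<psi> j c x \<le> 2 * (\<tau> / 4 ^ j)) \<and>
      (\<forall>c. \<forall>x\<in>mspace K. \<forall>y\<in>mspace K. \<bar>\<psi> j c x - \<psi> j c y\<bar> \<le> mdist K x y) \<and>
      (\<forall>x\<in>mspace K. \<forall>y\<in>mspace K. 4 * (\<tau> / 4 ^ j) \<le> mdist K x y \<longrightarrow>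
         mdist K x y \<le> 16 * (\<tau> / 4 ^ j) \<longrightarrow>
         (\<exists>c \<le> N ^ 6. \<tau> / 4 ^ j \<le> \<bar>\<psi> j c x - \<psi> j c y\<bar>))" ..
  have \<psi>0: "0 \<le> \<psi> j c x" and \<psi>2: "\<psi> j c x \<le> 2 * (\<tau> / 4 ^ j)" for j c x
    using spec[OF \<psi>, of j] by simp_all
  have lip: "\<bar>\<psi> j c x - \<psi> j c y\<bar> \<le> mdist K x y" if "x \<in> mspace K" "y \<in> mspace K" for j c x y
    using spec[OF \<psi>, of j] that by simp
  have split: "\<exists>c \<le> N ^ 6. \<tau> / 4 ^ j \<le> \<bar>\<psi> j c x - \<psi> j c y\<bar>"
    if "x \<in> mspace K" "y \<in> mspace K" "4 * (\<tau> / 4 ^ j) < mdist K x y"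
      "mdist K x y \<le> 16 * (\<tau> / 4 ^ j)" for j x y
    using spec[OF \<psi>, of j] that by simp
  define a where "a s c x i = 2 ^ (s + 7 * i) * \<psi> (s + 7 * i) c x" for s c x i
  define h where "h x n = (if n < d then suminf (a (n mod 7) (n div 7) x) else 0)" for x n
  have four: "(4::real) ^ j = 2 ^ j * 2 ^ j" for j
    by (simp flip: power_mult_distrib)
  have sum_a: "summable (a s c x)" for s c x
  proof (rule suminf_near_peak(1)[of _ "2 * \<tau>" 0])
    fix i
    have "\<bar>a s c x i\<bar> \<le> 2 ^ (s + 7 * i) * (2 * (\<tau> / 4 ^ (s + 7 * i)))"
      unfolding a_def abs_mult using \<psi>0 \<psi>2 by (intro mult_mono) auto
    also have "\<dots> = 2 * \<tau> * (1 / 2) ^ (s + 7 * i)"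
      unfolding four by (simp add: power_one_over)
    also have "\<dots> \<le> 2 * \<tau> * (1 / 2) ^ (7 * i)"
      using \<tau> by (intro mult_left_mono power_decreasing) auto
    finally show "\<bar>a s c x i\<bar> \<le> 2 * \<tau> * (1 / 128) ^ (i - 0 + (0 - i))"
      by (simp add: power_mult power_one_over)
  qed
  have main: "sqrt \<tau> / 8 * sqrt (mdist K x y) \<le> mdist (euclid d) (h x) (h y) \<and>
      mdist (euclid d) (h x) (h y) \<le> d * (1024 * sqrt \<tau> * sqrt (mdist K x y))"
    if xy: "x \<in> mspace K" "y \<in> mspace K" and ne: "x \<noteq> y" for x y
  proof -
    have pos: "0 < mdist K x y" using xy ne by (metis less_eq_real_def mdist_nonneg mdist_zero)
    obtain J where J: "4 * (\<tau> / 4 ^ J) < mdist K x y" "mdist K x y \<le> 16 * (\<tau> / 4 ^ J)"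
      using scale_of_distance[OF pos, of \<tau>] bd(2) xy by (auto simp: \<tau>_def)
    define S where "S = 16 * \<tau> / 2 ^ J"
    have S0: "0 \<le> S" using \<tau> by (simp add: S_def)
    have S2: "S\<^sup>2 = 16 * \<tau> * (16 * (\<tau> / 4 ^ J))" unfolding S_def four by (simp add: power2_eq_square)
    have S_up: "S \<le> 8 * sqrt \<tau> * sqrt (mdist K x y)"
    proof -
      have "S\<^sup>2 \<le> 16 * \<tau> * (4 * mdist K x y)"
        unfolding S2 using J(1) \<tau> by (intro mult_left_mono) auto
      then have "S \<le> sqrt (64 * (\<tau> * mdist K x y))" by (intro real_le_rsqrt) (simp add: mult.assoc)
      then show ?thesis by (simp add: real_sqrt_mult mult.assoc)
    qed
    have S_lo: "4 * sqrt \<tau> * sqrt (mdist K x y) \<le> S"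
    proof -
      have "16 * \<tau> * mdist K x y \<le> S\<^sup>2"
        unfolding S2 using J(2) \<tau> by (intro mult_left_mono) auto
      then have "sqrt (16 * (\<tau> * mdist K x y)) \<le> S"
        using S0 by (intro real_le_lsqrt) (simp_all add: mult.assoc)
      then show ?thesis by (simp add: real_sqrt_mult mult.assoc)
    qed
    define b where "b s c i = a s c x i - a s c y i" for s c i
    have hb: "h x n - h y n = suminf (b (n mod 7) (n div 7))" if "n < d" for n
      using that suminf_diff[OF sum_a sum_a] by (simp add: h_def b_def[abs_def])
    \<comment> \<open>The exponent is \<open>\<bar>j - J\<bar>\<close> for \<open>j = s + 7 * i\<close>, written with truncated subtraction.\<close>
    have b_le: "\<bar>b s c i\<bar> \<le> S * (1 / 2) ^ ((s + 7 * i - J) + (J - (s + 7 * i)))" for s c i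
    proof -
      define k where "k = s + 7 * i"
      have b: "\<bar>b s c i\<bar> = 2 ^ k * \<bar>\<psi> k c x - \<psi> k c y\<bar>"
        by (simp add: b_def a_def k_def abs_mult flip: right_diff_distrib)
      show ?thesis
      proof (cases "J \<le> k")
        case True
        have "\<bar>\<psi> k c x - \<psi> k c y\<bar> \<le> 2 * (\<tau> / 4 ^ k)"
          using \<psi>0[of k c x] \<psi>0[of k c y] \<psi>2[of k c x] \<psi>2[of k c y] by linarith
        then have "\<bar>b s c i\<bar> \<le> 2 ^ k * (2 * (\<tau> / 4 ^ k))" unfolding b by (intro mult_left_mono) auto
        also have "\<dots> = 2 * \<tau> / 2 ^ k" unfolding four by simp
        also have "\<dots> \<le> 16 * \<tau> / 2 ^ k" using \<tau> by (intro divide_right_mono) auto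
        also have "\<dots> = S * (1 / 2) ^ (k - J)"
          using True by (simp add: S_def power_one_over power_diff)
        finally show ?thesis using True by (simp add: k_def)
      next
        case False
        have "\<bar>\<psi> k c x - \<psi> k c y\<bar> \<le> 16 * (\<tau> / 4 ^ J)" using lip[OF xy] J(2) order_trans by blast
        then have "\<bar>b s c i\<bar> \<le> 2 ^ k * (16 * (\<tau> / 4 ^ J))" unfolding b by (intro mult_left_mono) auto
        also have "\<dots> = S * (1 / 2) ^ (J - k)"
          unfolding four using False by (simp add: S_def power_one_over power_diff)
        finally show ?thesis using False by (simp add: k_def)
      qed
    qed
    define I where "I = J div 7"
    have pow7: "(1 / 2 :: real) ^ (7 * n) = (1 / 128) ^ n" for n
      by (simp add: power_mult power_one_over)
    have "\<bar>h x n - h y n\<bar> \<le> 1024 * sqrt \<tau> * sqrt (mdist K x y)" if n: "n < d" for n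
    proof -
      let ?s = "n mod 7" and ?c = "n div 7"
      \<comment> \<open>In a residue class that need not contain \<open>J\<close> the peak is at \<open>I\<close> only up to an offset of at
        most 6 scales, which costs the factor \<open>64 = 2 ^ 6\<close>.\<close>
      have "\<bar>b ?s ?c i\<bar> \<le> 64 * S * (1 / 128) ^ ((i - I) + (I - i))" for i
      proof -
        define e where "e = (?s + 7 * i - J) + (J - (?s + 7 * i))"
        have "7 * ((i - I) + (I - i)) \<le> e + 6"
        proof -
          have "J mod 7 + 7 * I = J" by (simp add: I_def)
          then show ?thesis
            using residue_distance_le[of ?s "J mod 7" i I] unfolding e_def by simp
        qed
        then have "(1 / 2 :: real) ^ (e + 6) \<le> (1 / 2) ^ (7 * ((i - I) + (I - i)))"
          by (intro power_decreasing) auto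
        then have "(1 / 2) ^ e \<le> 64 * (1 / 128 :: real) ^ ((i - I) + (I - i))"
          unfolding pow7 power_add[of _ e 6] by (simp add: power_divide)
        then have "S * (1 / 2) ^ e \<le> S * (64 * (1 / 128) ^ ((i - I) + (I - i)))"
          using S0 by (intro mult_left_mono)
        then show ?thesis using b_le[of ?s ?c i] unfolding e_def by linarith
      qed
      from suminf_near_peak(3)[OF this] have "\<bar>h x n - h y n\<bar> \<le> 128 * S" using hb[OF n] by simp
      then show ?thesis using S_up by linarith
    qed
    then have "mdist (euclid d) (h x) (h y) \<le> d * (1024 * sqrt \<tau> * sqrt (mdist K x y))"
      by (rule euclid_le_coordinates)
    moreover have "sqrt \<tau> / 8 * sqrt (mdist K x y) \<le> mdist (euclid d) (h x) (h y)"
    proof -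
      obtain c where c: "c \<le> N ^ 6" "\<tau> / 4 ^ J \<le> \<bar>\<psi> J c x - \<psi> J c y\<bar>"
        using split[OF xy J] by (elim exE conjE)
      define s where "s = J mod 7"
      define n where "n = s + 7 * c"
      have s7: "s < 7" by (simp add: s_def)
      have n: "n < d" "n mod 7 = s" "n div 7 = c" using c(1) s7 by (auto simp: n_def d_def M_def)
      have JI: "s + 7 * I = J" by (simp add: s_def I_def)
      have "\<bar>b s c i\<bar> \<le> S * (1 / 128) ^ ((i - I) + (I - i))" for i
      proof -
        have "(s + 7 * i - J) + (J - (s + 7 * i)) = 7 * ((i - I) + (I - i))"
          unfolding JI[symmetric] by (simp add: diff_mult_distrib2 distrib_left)
        then show ?thesis using b_le[of s c i] by (simp only: pow7)
      qed
      from suminf_near_peak(2)[OF this] have "\<bar>b s c I\<bar> \<le> \<bar>h x n - h y n\<bar> + S / 32"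
        using hb[OF n(1)] unfolding n(2,3) by linarith
      moreover have "S / 16 \<le> \<bar>b s c I\<bar>"
      proof -
        have "S / 16 = 2 ^ J * (\<tau> / 4 ^ J)" unfolding four by (simp add: S_def)
        also have "\<dots> \<le> 2 ^ J * \<bar>\<psi> J c x - \<psi> J c y\<bar>" using c(2) by (intro mult_left_mono) auto
        also have "\<dots> = \<bar>b s c I\<bar>"
          by (simp add: b_def a_def JI abs_mult flip: right_diff_distrib)
        finally show ?thesis .
      qed
      ultimately have "S / 32 \<le> \<bar>h x n - h y n\<bar>" by linarith
      also have "\<dots> \<le> mdist (euclid d) (h x) (h y)" by (rule coordinate_le_euclid[OF n(1)])
      finally show ?thesis using S_lo by linarith
    qed
    ultimately show ?thesis by blast
  qed
  have d0: "0 < d" by (simp add: d_def M_def)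
  have bounds: "sqrt \<tau> / 8 * mdist K x y powr (1 / 2) \<le> mdist (euclid d) (h x) (h y)"
      "mdist (euclid d) (h x) (h y) \<le> d * (1024 * sqrt \<tau>) * mdist K x y powr (1 / 2)"
    if xy: "x \<in> mspace K" "y \<in> mspace K" for x y
  proof -
    have "sqrt \<tau> / 8 * sqrt (mdist K x y) \<le> mdist (euclid d) (h x) (h y) \<and>
      mdist (euclid d) (h x) (h y) \<le> d * (1024 * sqrt \<tau> * sqrt (mdist K x y))"
    proof (cases "x = y")
      case True
      then have "mdist K x y = 0" using xy by simp
      then show ?thesis using True by (simp add: L2_set_def)
    qed (rule main[OF xy])
    then show "sqrt \<tau> / 8 * mdist K x y powr (1 / 2) \<le> mdist (euclid d) (h x) (h y)"
      "mdist (euclid d) (h x) (h y) \<le> d * (1024 * sqrt \<tau>) * mdist K x y powr (1 / 2)"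
      by (simp_all only: powr_half_sqrt mdist_nonneg mult.assoc)
  qed
  have "h x \<in> mspace (euclid d)" for x by (simp add: h_def)
  then show ?thesis
    using bounds \<tau> d0
    by (intro exI[of _ d] exI[of _ h] exI[of _ "sqrt \<tau> / 8"] exI[of _ "d * (1024 * sqrt \<tau>)"]
        conjI ballI allI) simp_all
qed

section \<open>The characterization of doubling fractals\<close>

theorem theorem4p1:
  fixes K :: "'a metric" and F :: "('a \<Rightarrow> 'a) set"
  assumes "metric_fractal K F"
  shows "doubling K \<longleftrightarrow>
    (\<exists>n::nat. n \<ge> 1 \<and>
      (\<exists>(d::nat) (L::(nat \<Rightarrow> real) set) G.
         fractal_in (euclid d) L G \<and>
         equi_Hoelder_equivalent K (comp_power K F n) (submetric (euclid d) L) G))"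
    (is "_ \<longleftrightarrow> ?R")
proof
  have K: "mspace K \<noteq> {}" "compact_space (mtopology_of K)" and fin: "finite F"
    and con: "\<And>f. f \<in> F \<Longrightarrow> contracting K f" and cov: "mspace K = (\<Union>f\<in>F. f ` mspace K)"
    using assms unfolding metric_fractal_def by blast+
  {
    assume "doubling K"
    then have "\<exists>N. doubling_with N K"
      by (rule iffD1[OF doubling_iff_doubling_with[OF K(2)]])
    then obtain N where N: "doubling_with N K" ..
    obtain B where B: "0 < B" "\<forall>x\<in>mspace K. \<forall>y\<in>mspace K. mdist K x y \<le> B"
      by (rule compact_space_imp_bounded_metric[OF K(2)]) simp
    obtain d and h :: "'a \<Rightarrow> nat \<Rightarrow> real" and c C :: real
      where cC: "0 < c" "0 < C" and hE: "\<forall>x. h x \<in> mspace (euclid d)"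
        and h: "\<forall>x\<in>mspace K. \<forall>y\<in>mspace K.
           c * mdist K x y powr (1 / 2) \<le> mdist (euclid d) (h x) (h y) \<and>
           mdist (euclid d) (h x) (h y) \<le> C * mdist K x y powr (1 / 2)"
      using Assouad_snowflake_embedding[OF N B] by (elim exE conjE)
    have lo: "c * mdist K x y powr (1 / 2) \<le> mdist (euclid d) (h x) (h y)"
      and up: "mdist (euclid d) (h x) (h y) \<le> C * mdist K x y powr (1 / 2)"
      if "x \<in> mspace K" "y \<in> mspace K" for x y
      using h that by simp_all
    obtain l where l: "0 < l" "l < 1"
      "\<And>f x y. f \<in> F \<Longrightarrow> x \<in> mspace K \<Longrightarrow> y \<in> mspace K \<Longrightarrow> mdist K (f x) (f y) \<le> l * mdist K x y"
      using metric_fractal_uniform_ratio[OF assms] by blast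
    \<comment> \<open>The number \<open>n\<close> of iterations has to beat the distortion \<open>C / c\<close> of \<open>h\<close> and the factor \<open>d\<close> lost
      in the extension.\<close>
    define A where "A = d * (C / c)"
    have A: "0 \<le> A" using cC by (simp add: A_def)
    obtain m where m: "sqrt l ^ m < 1 / (A + 1)"
      using real_arch_pow_inv[of "1 / (A + 1)" "sqrt l"] A l by auto
    define n where "n = Suc m"
    have "(l ^ n) powr (1 / 2) = sqrt l ^ n"
      using l by (simp add: powr_half_sqrt real_sqrt_power)
    also have "\<dots> \<le> sqrt l ^ m" unfolding n_def using l by (intro power_decreasing) auto
    finally have "A * (l ^ n) powr (1 / 2) \<le> A * (1 / (A + 1))"
      using m A by (intro mult_left_mono) auto
    also have "\<dots> < 1" using A by simp
    finally have small: "d * (C / c * (l ^ n) powr (1 / 2)) < 1" by (simp add: A_def mult.assoc)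
    define L where "L = h ` mspace K"
    have LE: "L \<subseteq> mspace (euclid d)" using hE by (auto simp: L_def)
    have g: "g \<in> mspace K \<rightarrow>\<^sub>E mspace K \<and>
        (\<forall>x\<in>mspace K. \<forall>y\<in>mspace K. mdist K (g x) (g y) \<le> l ^ n * mdist K x y)"
      if "g \<in> comp_power K F n" for g
    proof (rule comp_power_Lipschitz[OF _ _ l(3) that])
      show "f \<in> mspace K \<rightarrow>\<^sub>E mspace K" if "f \<in> F" for f
        using con[OF that] unfolding contracting_def by (rule conjunct1)
    qed (use l in simp_all)
    have "fractal_in (euclid d) L
        {restrict (h \<circ> f \<circ> inv_into (mspace K) h) L | f. f \<in> comp_power K F n}"
    proof (rule conjugate_fractal_in_euclid[OF K(2,1) L_def[symmetric] LE cC _ lo up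
          finite_comp_power[OF fin] comp_power_covers[OF cov] _ _ _ small])
      show "f \<in> mspace K \<rightarrow>\<^sub>E mspace K" if "f \<in> comp_power K F n" for f
        using g[OF that] by (rule conjunct1)
      show "mdist K (f x) (f y) \<le> l ^ n * mdist K x y"
        if "f \<in> comp_power K F n" "x \<in> mspace K" "y \<in> mspace K" for f x y
        using g[OF that(1)] that(2,3) by simp
    qed (use l in simp_all)
    moreover have "equi_Hoelder_homeomorphism K (submetric (euclid d) L) h"
      by (rule Hoelder_imp_equi_Hoelder_homeomorphism[OF K(2) L_def[symmetric] LE cC _ lo up]) auto
    moreover have "mspace (submetric (euclid d) L) = L"
      using LE by (simp only: mspace_submetric) blast
    ultimately have "fractal_in (euclid d) L
        {restrict (h \<circ> f \<circ> inv_into (mspace K) h) L | f. f \<in> comp_power K F n} \<and>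
      equi_Hoelder_equivalent K (comp_power K F n) (submetric (euclid d) L)
        {restrict (h \<circ> f \<circ> inv_into (mspace K) h) L | f. f \<in> comp_power K F n}"
      unfolding equi_Hoelder_equivalent_def by metis
    moreover have "1 \<le> n" by (simp add: n_def)
    ultimately show ?R by blast
  }
  assume ?R
  then obtain d L and h :: "'a \<Rightarrow> nat \<Rightarrow> real"
    where "equi_Hoelder_homeomorphism K (submetric (euclid d) L) h"
    unfolding equi_Hoelder_equivalent_def by blast
  then obtain c C \<alpha> :: real where "0 < c" "0 < C" "0 < \<alpha>"
    and "\<forall>x\<in>mspace K. \<forall>y\<in>mspace K. c * mdist K x y powr \<alpha> \<le> mdist (euclid d) (h x) (h y) \<and>
           mdist (euclid d) (h x) (h y) \<le> C * mdist K x y powr \<alpha>"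
    unfolding equi_Hoelder_homeomorphism_def mdist_submetric by blast
  then show "doubling K"
    by (intro doubling_if_Hoelder_into_euclid[OF K(2), of c C \<alpha> d h]) blast+
qed

end
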